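(* Let $K$ be a field, $S=K[x_1,\dots,x_n]$, let $u\in S$ be a monomial and let $I=B(u)$ be the principal Borel ideal generated by $u$. Then, for every $i\ge0$, $$\mathrm{HS}_i(I^{k+1})=I\cdot\mathrm{HS}_i(I^k)\quad\text{for all }k\ge1.$$
   Context: $S$ carries its standard $\mathbb{Z}^n$-grading. For a monomial ideal $J\subset S$ and $i\ge0$, the $i$th homological shift ideal is $\mathrm{HS}_i(J)=(\mathbf{x}^{\mathbf a}:\ \mathrm{Tor}_i^S(K,J)_{\mathbf a}\neq0)$, where $\mathbf{x}^{\mathbf a}=x_1^{a_1}\cdots x_n^{a_n}$ (the zero ideal if $\mathrm{Tor}_i^S(K,J)=0$). For a monomial $u=x_{j_1}\cdots x_{j_d}$ with $1\le j_1\le\dots\le j_d\le n$, the principal Borel ideal generated by $u$ is $$B(u)=(x_{p_1}\cdots x_{p_d}:\ 1\le p_1\le\dots\le p_d\le n,\ p_s\le j_s\text{ for all }s=1,\dots,d).$$ *)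

theory Defs
  imports "HOL-Library.Poly_Mapping" Complex_Main
begin

section \<open>The polynomial ring and its ideals\<close>

text \<open>The variables are indexed by a finite linearly ordered type \<open>'n\<close>, which plays the role of
  \<open>1 < 2 < \<dots> < n\<close>. A monomial is its exponent vector, and a polynomial is a finitely supported
  family of coefficients indexed by the exponent vectors.\<close>

type_synonym 'n monom = "'n \<Rightarrow>\<^sub>0 nat"
type_synonym ('n, 'k) mpoly = "('n \<Rightarrow>\<^sub>0 nat) \<Rightarrow>\<^sub>0 'k"

definition monomial :: "'n monom \<Rightarrow> ('n, 'k::field) mpoly" where
  "monomial t = Poly_Mapping.single t 1"

text \<open>Ideals of a commutative ring are its submodules; \<open>ideal.span X\<close> is the ideal generated
  by \<open>X\<close>.\<close>

interpretation ideal: module "(*) :: 'a::comm_ring_1 \<Rightarrow> 'a \<Rightarrow> 'a"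
  by standard (simp_all add: algebra_simps)

definition ideal_mult :: "'a::comm_ring_1 set \<Rightarrow> 'a set \<Rightarrow> 'a set" where
  "ideal_mult I J = ideal.span {f * g | f g. f \<in> I \<and> g \<in> J}"

primrec ideal_power :: "'a::comm_ring_1 set \<Rightarrow> nat \<Rightarrow> 'a set" where
  "ideal_power I 0 = UNIV"
| "ideal_power I (Suc k) = ideal_mult I (ideal_power I k)"

text \<open>The degree of a monomial in \<open>\<int>\<^sup>n\<close>, and the graded component \<open>S\<^sub>d\<close>. It is zero as soon as \<open>d\<close>
  has a negative entry.\<close>

definition mdeg :: "'n monom \<Rightarrow> 'n \<Rightarrow>\<^sub>0 int" where
  "mdeg t = Poly_Mapping.map int t"

definition component :: "('n \<Rightarrow>\<^sub>0 int) \<Rightarrow> ('n, 'k::field) mpoly set" where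
  "component d = {f. \<forall>t \<in> Poly_Mapping.keys f. mdeg t = d}"


section \<open>Graded free resolutions of the residue field\<close>

text \<open>A complex \<open>\<dots> \<rightarrow> P\<^sub>2 \<rightarrow> P\<^sub>1 \<rightarrow> P\<^sub>0 \<rightarrow> K\<close> of free \<open>S\<close>-modules of finite rank, given by matrices:
  \<open>P\<^sub>i\<close> is free on the basis elements \<open>e\<^sub>b\<close> for \<open>b \<in> basis P i\<close>, of degree \<open>bdeg P i b\<close>; the
  differential \<open>P\<^sub>i\<^sub>+\<^sub>1 \<rightarrow> P\<^sub>i\<close> sends \<open>e\<^sub>c\<close> to the sum of all \<open>coef P i b c * e\<^sub>b\<close>; and the augmentation
  \<open>P\<^sub>0 \<rightarrow> K\<close> sends \<open>e\<^sub>b\<close> to \<open>aug P b\<close>.\<close>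

record (overloaded) ('n, 'k) free_complex =
  basis :: "nat \<Rightarrow> nat set"
  bdeg :: "nat \<Rightarrow> nat \<Rightarrow> 'n \<Rightarrow>\<^sub>0 int"
  coef :: "nat \<Rightarrow> nat \<Rightarrow> nat \<Rightarrow> ('n, 'k) mpoly"
  aug :: "nat \<Rightarrow> 'k"

definition chains :: "('n, 'k::field) free_complex \<Rightarrow> nat \<Rightarrow> (nat \<Rightarrow> ('n, 'k) mpoly) set" where
  "chains P i = {v. \<forall>b. b \<notin> basis P i \<longrightarrow> v b = 0}"

definition diff :: "('n, 'k::field) free_complex \<Rightarrow> nat \<Rightarrow>
    (nat \<Rightarrow> ('n, 'k) mpoly) \<Rightarrow> nat \<Rightarrow> ('n, 'k) mpoly" where
  "diff P i v = (\<lambda>b. if b \<in> basis P i then \<Sum>c\<in>basis P (Suc i). coef P i b c * v c else 0)"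

text \<open>\<open>K = S/(x\<^sub>1, \<dots>, x\<^sub>n)\<close>, so a polynomial acts on \<open>K\<close> through its constant coefficient.\<close>

definition augment :: "('n, 'k::field) free_complex \<Rightarrow> (nat \<Rightarrow> ('n, 'k) mpoly) \<Rightarrow> 'k" where
  "augment P v = (\<Sum>b\<in>basis P 0. Poly_Mapping.lookup (v b) 0 * aug P b)"

definition graded_free_resolution :: "('n, 'k::field) free_complex \<Rightarrow> bool" where
  "graded_free_resolution P \<longleftrightarrow>
     (\<forall>i. finite (basis P i)) \<and>
     (\<forall>i. \<forall>b \<in> basis P i. \<forall>c \<in> basis P (Suc i).
        coef P i b c \<in> component (bdeg P (Suc i) c - bdeg P i b)) \<and>
     (\<forall>b \<in> basis P 0. aug P b \<noteq> 0 \<longrightarrow> bdeg P 0 b = 0) \<and>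
     augment P ` chains P 0 = UNIV \<and>
     {v \<in> chains P 0. augment P v = 0} = diff P 0 ` chains P 1 \<and>
     (\<forall>i. {v \<in> chains P (Suc i). diff P i v = (\<lambda>_. 0)} =
        diff P (Suc i) ` chains P (Suc (Suc i)))"

text \<open>As usual, one resolution of \<open>K\<close> is fixed (the Koszul complex is one, and Tor does not depend
  on the choice up to isomorphism of graded modules).\<close>

definition residue_field_resolution :: "('n::finite, 'k::field) free_complex" where
  "residue_field_resolution = (SOME P. graded_free_resolution P)"


section \<open>Tor and the homological shift ideals\<close>

text \<open>For an ideal \<open>J\<close>, the module \<open>P\<^sub>i \<otimes>\<^sub>S J\<close> consists of the families \<open>(v\<^sub>b)\<close> with entries in \<open>J\<close>,
  the family standing for the sum of all \<open>e\<^sub>b \<otimes> v\<^sub>b\<close>; the component of degree \<open>d\<close> is cut out by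
  \<open>v\<^sub>b \<in> S\<^bsub>d - deg e\<^sub>b\<^esub>\<close>.\<close>

definition tensor_component :: "('n, 'k::field) free_complex \<Rightarrow> nat \<Rightarrow> ('n, 'k) mpoly set \<Rightarrow>
    ('n \<Rightarrow>\<^sub>0 int) \<Rightarrow> (nat \<Rightarrow> ('n, 'k) mpoly) set" where
  "tensor_component P i J d =
     {v \<in> chains P i. \<forall>b \<in> basis P i. v b \<in> J \<inter> component (d - bdeg P i b)}"

fun tensor_cycles :: "('n, 'k::field) free_complex \<Rightarrow> nat \<Rightarrow> ('n, 'k) mpoly set \<Rightarrow>
    ('n \<Rightarrow>\<^sub>0 int) \<Rightarrow> (nat \<Rightarrow> ('n, 'k) mpoly) set" where
  "tensor_cycles P 0 J d = tensor_component P 0 J d"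
| "tensor_cycles P (Suc i) J d = {v \<in> tensor_component P (Suc i) J d. diff P i v = (\<lambda>_. 0)}"

definition tensor_boundaries :: "('n, 'k::field) free_complex \<Rightarrow> nat \<Rightarrow> ('n, 'k) mpoly set \<Rightarrow>
    ('n \<Rightarrow>\<^sub>0 int) \<Rightarrow> (nat \<Rightarrow> ('n, 'k) mpoly) set" where
  "tensor_boundaries P i J d = diff P i ` tensor_component P (Suc i) J d"

text \<open>\<open>Tor i J d\<close> is the component of degree \<open>d\<close> of \<open>Tor\<^sub>i\<^sup>S(K, J)\<close>, as the set of residue classes
  of cycles modulo boundaries; its zero element is the class of the boundaries.\<close>

definition Tor :: "nat \<Rightarrow> ('n::finite, 'k::field) mpoly set \<Rightarrow> ('n \<Rightarrow>\<^sub>0 int) \<Rightarrow>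
    (nat \<Rightarrow> ('n, 'k) mpoly) set set" where
  "Tor i J d = (let P = residue_field_resolution in
     tensor_cycles P i J d //
       {(v, w). (\<lambda>b. w b - v b) \<in> tensor_boundaries P i J d})"

definition Tor_nonzero :: "nat \<Rightarrow> ('n::finite, 'k::field) mpoly set \<Rightarrow> ('n \<Rightarrow>\<^sub>0 int) \<Rightarrow> bool" where
  "Tor_nonzero i J d \<longleftrightarrow> Tor i J d \<noteq> {tensor_boundaries residue_field_resolution i J d}"

text \<open>Since \<open>J\<close> is contained in \<open>S\<close>, Tor lives in degrees with nonnegative entries only, so it is
  enough to range over the exponent vectors \<open>a\<close>.\<close>

definition HS :: "nat \<Rightarrow> ('n::finite, 'k::field) mpoly set \<Rightarrow> ('n, 'k) mpoly set" where
  "HS i J = ideal.span {monomial a | a. Tor_nonzero i J (mdeg a)}"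


section \<open>Principal Borel ideals\<close>

definition monom_of_list :: "'n list \<Rightarrow> 'n monom" where
  "monom_of_list js = (\<Sum>j\<leftarrow>js. Poly_Mapping.single j 1)"

text \<open>The sorted list \<open>js\<close> is the unique factorization \<open>u = x\<^bsub>j\<^sub>1\<^esub> \<cdots> x\<^bsub>j\<^sub>d\<^esub>\<close> with increasing indices.\<close>

definition principal_borel :: "'n::{finite, linorder} monom \<Rightarrow> ('n, 'k::field) mpoly set" where
  "principal_borel u = ideal.span {monomial (monom_of_list ps) | ps js.
     sorted js \<and> monom_of_list js = u \<and> sorted ps \<and> list_all2 (\<le>) ps js}"

end

theory Submission
  imports Defs "HOL-Library.Countable_Set" "HOL-Library.Multiset"
begin

text \<open>The powers of \<open>I\<close> are stable ideals generated in one degree. Since Tor may be computed from any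
  graded free resolution of \<open>K\<close>, in degree \<open>a\<close> it is the homology of the upper Koszul simplicial
  complex of \<open>a\<close>. For a stable ideal, coning over the largest variable of \<open>a\<close> contracts this complex
  unless \<open>x\<^sup>a = w x\<^sub>G\<close> with \<open>w\<close> a minimal generator and \<open>G\<close> a set of \<open>i\<close> variables, all smaller than the
  largest variable of \<open>w\<close>; and in such a degree the boundary of the simplex on \<open>G\<close> and that largest
  variable is a nonzero class. Hence \<open>HS\<^sub>i\<close> is generated by the monomials \<open>w x\<^sub>G\<close>, and the formula
  amounts to factoring a generator of \<open>I\<^sup>k\<^sup>+\<^sup>1\<close> into one of \<open>I\<close> and one of \<open>I\<^sup>k\<close> that contains its
  largest variable.\<close>

text \<open>Tor is defined from a resolution picked by a choice operator, so no class can be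
  exhibited before a comparison theorem is available. For \<open>HS\<close> it only matters whether
  Tor vanishes in a given degree, so the comparison shows no more than this: exactness of the
  tensored complex at one homological degree and one multidegree passes from any resolution to any
  other. The Koszul complex then serves twice, as the witness that a resolution exists and as the
  complex in which degrees are computed. Nonvanishing rests on the generators of a power all having
  one total degree D. An Eliahou-Kervaire degree has total degree D + i, hence no face of its upper
  Koszul complex has i + 1 elements, and a nonzero cycle on faces with i elements has nothing to
  bound it. The final identity is proved as an equality of two sets of monomials, not only of the
  ideals that they span.\<close>

section \<open>Graded polynomials and monomial ideals\<close>

text \<open>As a simplification rule, this instance is the reverse of associativity and loops with it.\<close>

declare ideal.scale_scale [simp del]

abbreviation "lookup \<equiv> Poly_Mapping.lookup"
abbreviation "keys \<equiv> Poly_Mapping.keys"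
abbreviation "single \<equiv> Poly_Mapping.single"

text \<open>Subtraction of exponent vectors truncates at zero, so \<open>r - t\<close> is a quotient
  of monomials only under the divisibility guard.\<close>

lemma lookup_single_mult:
  fixes f :: "('n, 'k::field) mpoly"
  shows "lookup (single t c * f) r = (if \<exists>s. r = t + s then c * lookup f (r - t) else 0)"
proof -
  have "lookup (single t c * f) r = (\<Sum>l. (c when t = l) * (\<Sum>q. lookup f q when r = l + q))"
    by (simp add: lookup_mult lookup_single)
  also have "\<dots> = (\<Sum>l. (c * (\<Sum>q. lookup f q when r = t + q)) when l = t)"
    by (intro Sum_any.cong) (auto simp: when_def)
  also have "\<dots> = c * (\<Sum>q. lookup f q when r = t + q)"
    by simp
  also have "(\<Sum>q. lookup f q when r = t + q) = (if \<exists>s. r = t + s then lookup f (r - t) else 0)"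
  proof (cases "\<exists>s. r = t + s")
    case True
    then obtain s where s: "r = t + s" by blast
    then have "(\<Sum>q. lookup f q when r = t + q) = (\<Sum>q. lookup f q when q = s)"
      by (intro Sum_any.cong) (auto simp: when_def)
    with s show ?thesis by simp
  next
    case False
    then have "\<And>q. (lookup f q when r = t + q) = 0"
      by (auto simp: when_def)
    with False show ?thesis by simp
  qed
  finally show ?thesis by simp
qed

lemma mpoly_eq_sum_single:
  fixes f :: "('n, 'k::field) mpoly"
  shows "f = (\<Sum>t\<in>keys f. single t (lookup f t))"
  by (rule poly_mapping_eqI)
     (auto simp: lookup_sum lookup_single when_def in_keys_iff sum.delta)

lemma poly_mapping_nat_add_eq_0_iff:
  fixes s t :: "'n monom"
  shows "s + t = 0 \<longleftrightarrow> s = 0 \<and> t = 0"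
  by (auto simp: poly_mapping_eq_iff lookup_add fun_eq_iff)

text \<open>Exponents are natural numbers, so 1 is a product of two monomials only when both are 1.
  This makes the augmentation linear over S acting on K by constant coefficients.\<close>

lemma lookup_mult_0:
  fixes f g :: "('n, 'k::field) mpoly"
  shows "lookup (f * g) 0 = lookup f 0 * lookup g 0"
proof -
  have "lookup (single t c * g) 0 = (if t = 0 then c * lookup g 0 else 0)" for t c
    by (simp add: lookup_single_mult poly_mapping_nat_add_eq_0_iff[THEN trans[OF eq_commute]])
  then have "lookup ((\<Sum>t\<in>keys f. single t (lookup f t)) * g) 0 =
      (\<Sum>t\<in>keys f. if t = 0 then lookup f t * lookup g 0 else 0)"
    by (simp add: sum_distrib_right lookup_sum)
  also have "\<dots> = lookup f 0 * lookup g 0"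
    by (simp add: sum.delta in_keys_iff)
  finally show ?thesis
    by (simp flip: mpoly_eq_sum_single)
qed

lemma lookup_mdeg [simp]: "lookup (mdeg t) j = int (lookup t j)"
  by (simp add: mdeg_def Poly_Mapping.map.rep_eq when_def)

lemma mdeg_add: "mdeg (s + t) = mdeg s + mdeg t"
  by (rule poly_mapping_eqI) (simp add: lookup_add)

lemma mdeg_0 [simp]: "mdeg 0 = 0"
  by (rule poly_mapping_eqI) simp

lemma mdeg_eq_iff [simp]: "mdeg s = mdeg t \<longleftrightarrow> s = t"
  by (auto simp: poly_mapping_eq_iff fun_eq_iff)

lemma component_0 [simp]: "0 \<in> component d"
  by (simp add: component_def)

lemma component_1: "1 \<in> component 0"
  by (simp add: component_def)

lemma component_add: "f \<in> component d \<Longrightarrow> g \<in> component d \<Longrightarrow> f + g \<in> component d"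
  using keys_add[of f g] by (auto simp: component_def)

lemma component_diff: "f \<in> component d \<Longrightarrow> g \<in> component d \<Longrightarrow> f - g \<in> component d"
  using keys_diff[of f g] by (auto simp: component_def)

lemma component_sum: "(\<And>x. x \<in> A \<Longrightarrow> f x \<in> component d) \<Longrightarrow> sum f A \<in> component d"
  by (induction A rule: infinite_finite_induct) (auto intro: component_add)

lemma component_mult:
  assumes "f \<in> component d" "g \<in> component e"
  shows "f * g \<in> component (d + e)"
  using keys_mult[of f g] assms by (fastforce simp: component_def mdeg_add)

lemma component_mult':
  assumes "f \<in> component (d - e)" "g \<in> component (e - c)"
  shows "f * g \<in> component (d - c)"
  using component_mult[OF assms] by simp

lemma single_in_component: "mdeg t = d \<Longrightarrow> single t c \<in> component d"
  by (auto simp: component_def)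

section \<open>Homogeneous parts of a polynomial\<close>

definition homogeneous_part :: "('n \<Rightarrow>\<^sub>0 int) \<Rightarrow> ('n, 'k::field) mpoly \<Rightarrow> ('n, 'k) mpoly" where
  "homogeneous_part d f = (\<Sum>t\<in>{t \<in> keys f. mdeg t = d}. single t (lookup f t))"

lemma lookup_homogeneous_part:
  "lookup (homogeneous_part d f) t = (if mdeg t = d then lookup f t else 0)"
  by (auto simp: homogeneous_part_def lookup_sum lookup_single when_def in_keys_iff sum.delta)

lemma homogeneous_part_in_component: "homogeneous_part d f \<in> component d"
  unfolding homogeneous_part_def by (rule component_sum) (auto intro: single_in_component)

lemma homogeneous_part_eq: "f \<in> component d \<Longrightarrow> homogeneous_part d f = f"
  by (rule poly_mapping_eqI) (auto simp: lookup_homogeneous_part component_def in_keys_iff)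

lemma homogeneous_part_0 [simp]: "homogeneous_part d 0 = 0"
  by (simp add: homogeneous_part_def)

lemma homogeneous_part_sum: "homogeneous_part d (sum f A) = (\<Sum>x\<in>A. homogeneous_part d (f x))"
  by (rule poly_mapping_eqI) (simp add: lookup_homogeneous_part lookup_sum)

text \<open>As \<open>f\<close> is homogeneous of degree \<open>e\<close>, a term of degree
  \<open>d\<close> in the product can only come from terms of \<open>g\<close> of degree
  \<open>d - e\<close>.\<close>

lemma homogeneous_part_mult:
  assumes "f \<in> component e"
  shows "homogeneous_part d (f * g) = f * homogeneous_part (d - e) g"
proof (rule poly_mapping_eqI)
  fix r
  let ?h = "homogeneous_part (d - e) g"
  have h: "f * ?h \<in> component d"
    using component_mult[OF assms homogeneous_part_in_component, of "d - e" g] by simp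
  have *: "r \<notin> keys (f * (g - ?h))" if "mdeg r = d"
  proof
    assume "r \<in> keys (f * (g - ?h))"
    then obtain s t where st: "r = s + t" "s \<in> keys f" "t \<in> keys (g - ?h)"
      using keys_mult by blast
    then have "mdeg t = d - e"
      using assms that by (auto simp: component_def mdeg_add)
    with st show False
      by (auto simp: in_keys_iff lookup_minus lookup_homogeneous_part)
  qed
  show "lookup (homogeneous_part d (f * g)) r = lookup (f * ?h) r"
  proof (cases "mdeg r = d")
    case True
    with * have "lookup (f * (g - ?h)) r = 0"
      by (simp add: in_keys_iff)
    with True show ?thesis
      by (simp add: lookup_homogeneous_part right_diff_distrib lookup_minus)
  next
    case False
    with h have "lookup (f * ?h) r = 0"
      by (auto simp: component_def in_keys_iff)
    with False show ?thesis
      by (simp add: lookup_homogeneous_part)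
  qed
qed

section \<open>Ideals spanned by monomials and their products\<close>

lemma monomial_add: "monomial (s + t) = (monomial s * monomial t :: ('n, 'k::field) mpoly)"
  by (simp add: monomial_def mult_single)

text \<open>The condition on the right is closed under sums and multiples, so it defines an ideal
  containing the generators; conversely, each term of such an \<open>f\<close> is a multiple of a
  generator.\<close>

lemma monomial_ideal_iff:
  fixes f :: "('n, 'k::field) mpoly"
  shows "f \<in> ideal.span (monomial ` M) \<longleftrightarrow> (\<forall>t\<in>keys f. \<exists>w\<in>M. \<exists>s. t = w + s)"
proof
  let ?T = "{f :: ('n, 'k) mpoly. \<forall>t\<in>keys f. \<exists>w\<in>M. \<exists>s. t = w + s}"
  assume "f \<in> ideal.span (monomial ` M)"
  moreover have "monomial ` M \<subseteq> ?T"
    by (force simp: monomial_def intro: exI[of _ 0])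
  moreover have "ideal.subspace ?T"
  proof (rule ideal.subspaceI)
    show "x + y \<in> ?T" if "x \<in> ?T" "y \<in> ?T" for x y
      using that keys_add[of x y] by blast
    show "c * x \<in> ?T" if x: "x \<in> ?T" for c x
    proof clarify
      fix t assume "t \<in> keys (c * x)"
      then obtain a b where "t = a + b" "b \<in> keys x"
        using keys_mult by blast
      moreover obtain w s where "w \<in> M" "b = w + s"
        using x \<open>b \<in> keys x\<close> by auto
      ultimately show "\<exists>w\<in>M. \<exists>s. t = w + s"
        by (intro bexI[of _ w] exI[of _ "a + s"]) (auto simp: ac_simps)
    qed
  qed simp
  ultimately show "\<forall>t\<in>keys f. \<exists>w\<in>M. \<exists>s. t = w + s"
    using ideal.span_minimal by blast
next
  assume *: "\<forall>t\<in>keys f. \<exists>w\<in>M. \<exists>s. t = w + s"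
  have "single t (lookup f t) \<in> ideal.span (monomial ` M)" if t: "t \<in> keys f" for t
  proof -
    obtain w s where w: "w \<in> M" "t = w + s" using * t by blast
    then have "single s (lookup f t) * monomial w \<in> ideal.span (monomial ` M)"
      by (intro ideal.span_scale ideal.span_base) auto
    with w show ?thesis
      by (simp add: monomial_def mult_single add.commute)
  qed
  then have "(\<Sum>t\<in>keys f. single t (lookup f t)) \<in> ideal.span (monomial ` M)"
    by (rule ideal.span_sum)
  then show "f \<in> ideal.span (monomial ` M)"
    by (simp flip: mpoly_eq_sum_single)
qed

lemma mult_in_subspace:
  assumes Z: "ideal.subspace Z" and XY: "\<And>x y. x \<in> X \<Longrightarrow> y \<in> Y \<Longrightarrow> x * y \<in> Z"
    and f: "f \<in> ideal.span X" and g: "g \<in> ideal.span Y"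
  shows "f * g \<in> Z"
  using f
proof (induction rule: ideal.span_induct_alt)
  case base
  show ?case using Z by (simp add: ideal.subspace_0)
next
  case outer: (step c x f)
  have "x * g \<in> Z"
    using g
  proof (induction rule: ideal.span_induct_alt)
    case base
    show ?case using Z by (simp add: ideal.subspace_0)
  next
    case (step c y g)
    have "c * (x * y) \<in> Z"
      using ideal.subspace_scale[OF Z, of "x * y" c] XY[OF \<open>x \<in> X\<close> \<open>y \<in> Y\<close>] by simp
    then have "c * (x * y) + x * g \<in> Z"
      using step Z by (intro ideal.subspace_add)
    then show ?case
      by (simp add: algebra_simps)
  qed
  then have "c * (x * g) \<in> Z"
    by (rule ideal.subspace_scale[OF Z])
  then show ?case
    using outer Z by (simp add: distrib_right ideal.subspace_add mult.assoc)
qed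

lemma ideal_mult_span:
  "ideal_mult (ideal.span X) (ideal.span Y) = ideal.span {x * y | x y. x \<in> X \<and> y \<in> Y}"
    (is "_ = ideal.span ?XY")
proof (rule antisym)
  have "f * g \<in> ideal.span ?XY" if "f \<in> ideal.span X" "g \<in> ideal.span Y" for f g
    by (rule mult_in_subspace[OF ideal.subspace_span _ that]) (blast intro: ideal.span_base)
  then show "ideal_mult (ideal.span X) (ideal.span Y) \<subseteq> ideal.span ?XY"
    unfolding ideal_mult_def by (intro ideal.span_minimal) auto
  show "ideal.span ?XY \<subseteq> ideal_mult (ideal.span X) (ideal.span Y)"
    unfolding ideal_mult_def by (rule ideal.span_mono) (auto intro: ideal.span_base)
qed

lemma ideal_mult_monomial:
  "ideal_mult (ideal.span (monomial ` A)) (ideal.span (monomial ` B)) =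
    (ideal.span (monomial ` {a + b | a b. a \<in> A \<and> b \<in> B}) :: ('n, 'k::field) mpoly set)"
proof -
  have "{x * y | x y. x \<in> monomial ` A \<and> y \<in> monomial ` B} =
      {monomial a * monomial b :: ('n, 'k) mpoly | a b. a \<in> A \<and> b \<in> B}"
    by blast
  also have "\<dots> = monomial ` {a + b | a b. a \<in> A \<and> b \<in> B}"
    unfolding monomial_add[symmetric] by blast
  finally show ?thesis
    by (simp only: ideal_mult_span)
qed

section \<open>Graded free resolutions and their comparison\<close>

text \<open>A homogeneous map of degree zero between graded free modules of finite rank, given by a
  matrix, with source basis \<open>C\<close> and target basis \<open>B\<close>.\<close>

definition matrix_map :: "nat set \<Rightarrow> nat set \<Rightarrow> (nat \<Rightarrow> nat \<Rightarrow> ('n, 'k::field) mpoly) \<Rightarrow>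
    (nat \<Rightarrow> ('n, 'k) mpoly) \<Rightarrow> nat \<Rightarrow> ('n, 'k) mpoly" where
  "matrix_map C B f v = (\<lambda>b. if b \<in> B then \<Sum>c\<in>C. f b c * v c else 0)"

definition graded_map :: "nat set \<Rightarrow> (nat \<Rightarrow> 'n \<Rightarrow>\<^sub>0 int) \<Rightarrow> nat set \<Rightarrow> (nat \<Rightarrow> 'n \<Rightarrow>\<^sub>0 int) \<Rightarrow>
    ((nat \<Rightarrow> ('n, 'k::field) mpoly) \<Rightarrow> nat \<Rightarrow> ('n, 'k) mpoly) \<Rightarrow> bool" where
  "graded_map C dC B dB \<phi> \<longleftrightarrow>
     (\<exists>f. (\<forall>b\<in>B. \<forall>c\<in>C. f b c \<in> component (dC c - dB b)) \<and> \<phi> = matrix_map C B f)"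

definition unit_vector :: "nat \<Rightarrow> nat \<Rightarrow> ('n, 'k::field) mpoly" where
  "unit_vector c = (\<lambda>b. if b = c then 1 else 0)"

lemma mult_unit_vector: "x * unit_vector c b = (if b = c then x else 0)"
  "unit_vector c b * x = (if b = c then x else 0)"
  by (simp_all add: unit_vector_def)

lemma matrix_map_sum:
  "matrix_map C B f (\<lambda>c. \<Sum>x\<in>A. a x * w x c) = (\<lambda>b. \<Sum>x\<in>A. a x * matrix_map C B f (w x) b)"
proof
  fix b
  have "(\<Sum>c\<in>C. f b c * (\<Sum>x\<in>A. a x * w x c)) = (\<Sum>c\<in>C. \<Sum>x\<in>A. a x * (f b c * w x c))"
    by (simp add: sum_distrib_left ac_simps)
  also have "\<dots> = (\<Sum>x\<in>A. \<Sum>c\<in>C. a x * (f b c * w x c))"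
    by (rule sum.swap)
  finally show "matrix_map C B f (\<lambda>c. \<Sum>x\<in>A. a x * w x c) b = (\<Sum>x\<in>A. a x * matrix_map C B f (w x) b)"
    by (simp add: matrix_map_def sum_distrib_left)
qed

lemma graded_map_sum:
  assumes "graded_map C dC B dB \<phi>"
  shows "\<phi> (\<lambda>c. \<Sum>x\<in>A. a x * w x c) = (\<lambda>b. \<Sum>x\<in>A. a x * \<phi> (w x) b)"
  using assms by (auto simp: graded_map_def matrix_map_sum)

lemma graded_map_add:
  assumes "graded_map C dC B dB \<phi>"
  shows "\<phi> (\<lambda>c. v c + w c) = (\<lambda>b. \<phi> v b + \<phi> w b)"
  using assms by (auto simp: graded_map_def matrix_map_def distrib_left sum.distrib)

lemma graded_map_diff:
  assumes "graded_map C dC B dB \<phi>"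
  shows "\<phi> (\<lambda>c. v c - w c) = (\<lambda>b. \<phi> v b - \<phi> w b)"
  using assms by (auto simp: graded_map_def matrix_map_def right_diff_distrib sum_subtractf)

lemma graded_map_0:
  assumes "graded_map C dC B dB \<phi>"
  shows "\<phi> (\<lambda>_. 0) = (\<lambda>_. 0)"
  using assms by (auto simp: graded_map_def matrix_map_def)

lemma graded_map_outside:
  assumes "graded_map C dC B dB \<phi>" "b \<notin> B"
  shows "\<phi> v b = 0"
  using assms by (auto simp: graded_map_def matrix_map_def)

lemma graded_map_unit_vector:
  assumes "graded_map C dC B dB \<phi>" "finite C" "c \<in> C" "b \<in> B"
  shows "\<phi> (unit_vector c) b \<in> component (dC c - dB b)"
  using assms by (auto simp: graded_map_def matrix_map_def mult_unit_vector)

lemma sum_unit_vector: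
  assumes "finite C" "\<forall>c. c \<notin> C \<longrightarrow> v c = 0"
  shows "v = (\<lambda>b. \<Sum>c\<in>C. v c * unit_vector c b)"
  using assms by (auto simp: mult_unit_vector)

lemma graded_map_expand:
  assumes "graded_map C dC B dB \<phi>" "finite C" "\<forall>c. c \<notin> C \<longrightarrow> v c = 0"
  shows "\<phi> v = (\<lambda>b. \<Sum>c\<in>C. v c * \<phi> (unit_vector c) b)"
  using graded_map_sum[OF assms(1), where A = C and a = v and w = unit_vector]
  unfolding sum_unit_vector[OF assms(2,3), symmetric] .

lemma graded_map_comp:
  assumes "graded_map C dC B dB \<phi>" "graded_map B dB A dA \<psi>" "finite C" "finite B"
  shows "graded_map C dC A dA (\<lambda>v. \<psi> (\<phi> v))"
proof -
  obtain f g where f: "\<forall>b\<in>B. \<forall>c\<in>C. f b c \<in> component (dC c - dB b)" "\<phi> = matrix_map C B f"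
    and g: "\<forall>a\<in>A. \<forall>b\<in>B. g a b \<in> component (dB b - dA a)" "\<psi> = matrix_map B A g"
    using assms(1,2) by (auto simp: graded_map_def)
  have "matrix_map B A g (matrix_map C B f v) = matrix_map C A (\<lambda>a c. \<Sum>b\<in>B. g a b * f b c) v" for v
  proof
    fix a
    have "(\<Sum>b\<in>B. g a b * (\<Sum>c\<in>C. f b c * v c)) = (\<Sum>b\<in>B. \<Sum>c\<in>C. g a b * f b c * v c)"
      by (simp add: sum_distrib_left mult.assoc)
    also have "\<dots> = (\<Sum>c\<in>C. \<Sum>b\<in>B. g a b * f b c * v c)"
      by (rule sum.swap)
    finally show "matrix_map B A g (matrix_map C B f v) a =
        matrix_map C A (\<lambda>a c. \<Sum>b\<in>B. g a b * f b c) v a"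
      by (simp add: matrix_map_def sum_distrib_right)
  qed
  moreover have "(\<Sum>b\<in>B. g a b * f b c) \<in> component (dC c - dA a)" if "a \<in> A" "c \<in> C" for a c
  proof (rule component_sum)
    fix b assume "b \<in> B"
    then have "f b c * g a b \<in> component (dC c - dA a)"
      using f(1) g(1) that by (intro component_mult') auto
    then show "g a b * f b c \<in> component (dC c - dA a)"
      by (simp add: mult.commute)
  qed
  ultimately show ?thesis
    unfolding graded_map_def f(2) g(2)
    by (intro exI[of _ "\<lambda>a c. \<Sum>b\<in>B. g a b * f b c"]) auto
qed

lemma graded_map_minus:
  assumes "graded_map C dC B dB \<phi>" "graded_map C dC B dB \<psi>"
  shows "graded_map C dC B dB (\<lambda>v b. \<phi> v b - \<psi> v b)"
proof -
  obtain f g where f: "\<forall>b\<in>B. \<forall>c\<in>C. f b c \<in> component (dC c - dB b)" "\<phi> = matrix_map C B f"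
    and g: "\<forall>b\<in>B. \<forall>c\<in>C. g b c \<in> component (dC c - dB b)" "\<psi> = matrix_map C B g"
    using assms(1,2) by (auto simp: graded_map_def)
  have "(\<lambda>v b. \<phi> v b - \<psi> v b) = matrix_map C B (\<lambda>b c. f b c - g b c)"
    by (intro ext) (simp add: f g matrix_map_def left_diff_distrib sum_subtractf)
  moreover have "\<forall>b\<in>B. \<forall>c\<in>C. f b c - g b c \<in> component (dC c - dB b)"
    using f g by (auto intro: component_diff)
  ultimately show ?thesis
    unfolding graded_map_def by (intro exI conjI)
qed

text \<open>A map given by a matrix vanishes outside its target basis, so the identity function is
  not of this kind; this projection replaces it and agrees with it on chains.\<close>

definition restrict_zero :: "nat set \<Rightarrow> (nat \<Rightarrow> ('n, 'k::field) mpoly) \<Rightarrow> nat \<Rightarrow> ('n, 'k) mpoly" where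
  "restrict_zero B v = (\<lambda>b. if b \<in> B then v b else 0)"

lemma graded_map_restrict_zero:
  assumes "finite B"
  shows "graded_map B dB B dB (restrict_zero B)"
proof -
  have "restrict_zero B = matrix_map B B (\<lambda>b. unit_vector b)"
    using assms by (intro ext)
      (simp add: restrict_zero_def matrix_map_def mult_unit_vector)
  moreover have "\<forall>b\<in>B. \<forall>c\<in>B. unit_vector b c \<in> component (dB c - dB b)"
    by (auto simp: unit_vector_def component_1)
  ultimately show ?thesis
    unfolding graded_map_def by (intro exI conjI)
qed

lemma graded_map_of_columns:
  assumes "\<And>c b. c \<in> C \<Longrightarrow> b \<in> B \<Longrightarrow> w c b \<in> component (dC c - dB b)"
    and "\<And>c b. c \<in> C \<Longrightarrow> b \<notin> B \<Longrightarrow> w c b = 0"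
  obtains \<theta> where "graded_map C dC B dB \<theta>" "\<And>v. \<theta> v = (\<lambda>b. \<Sum>c\<in>C. v c * w c b)"
proof
  show "graded_map C dC B dB (matrix_map C B (\<lambda>b c. w c b))"
    unfolding graded_map_def using assms(1) by (intro exI conjI ballI) auto
  show "matrix_map C B (\<lambda>b c. w c b) v = (\<lambda>b. \<Sum>c\<in>C. v c * w c b)" for v
    using assms by (auto simp: matrix_map_def mult.commute intro!: sum.neutral[symmetric])
qed

locale resolution =
  fixes P :: "('n::finite, 'k::field) free_complex"
  assumes res: "graded_free_resolution P"
begin

lemma finite_basis [simp]: "finite (basis P i)"
  using res by (simp add: graded_free_resolution_def)

lemma aug_bdeg: "b \<in> basis P 0 \<Longrightarrow> aug P b \<noteq> 0 \<Longrightarrow> bdeg P 0 b = 0"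
  using res by (simp add: graded_free_resolution_def)

lemma coef_component:
  "b \<in> basis P i \<Longrightarrow> c \<in> basis P (Suc i) \<Longrightarrow> coef P i b c \<in> component (bdeg P (Suc i) c - bdeg P i b)"
  using res by (simp add: graded_free_resolution_def)

lemma graded_map_diff_op: "graded_map (basis P (Suc i)) (bdeg P (Suc i)) (basis P i) (bdeg P i) (diff P i)"
  unfolding graded_map_def using coef_component
  by (intro exI[of _ "coef P i"]) (auto simp: diff_def matrix_map_def fun_eq_iff)

text \<open>The augmentation counts as the differential out of \<open>P\<^sub>0\<close>.\<close>

definition cycles :: "nat \<Rightarrow> (nat \<Rightarrow> ('n, 'k) mpoly) set" where
  "cycles i = {v \<in> chains P i. case i of 0 \<Rightarrow> augment P v = 0 | Suc j \<Rightarrow> diff P j v = (\<lambda>_. 0)}"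

lemma cycles_0: "cycles 0 = {v \<in> chains P 0. augment P v = 0}"
  and cycles_Suc: "cycles (Suc i) = {v \<in> chains P (Suc i). diff P i v = (\<lambda>_. 0)}"
  by (auto simp: cycles_def)

lemma cycles_eq_image: "cycles i = diff P i ` chains P (Suc i)"
  using res by (cases i) (simp_all add: cycles_0 cycles_Suc graded_free_resolution_def)

lemma diff_in_cycles: "v \<in> chains P (Suc i) \<Longrightarrow> diff P i v \<in> cycles i"
  by (auto simp: cycles_eq_image)

text \<open>Exactness is stated for arbitrary chains. The differential has degree zero, so the
  homogeneous part of any preimage is again a preimage of the homogeneous cycle.\<close>

lemma homogeneous_cycle_is_boundary:
  assumes "z \<in> cycles i" "\<And>b. b \<in> basis P i \<Longrightarrow> z b \<in> component (d - bdeg P i b)"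
  obtains w where "w \<in> chains P (Suc i)" "diff P i w = z"
    "\<And>b. b \<in> basis P (Suc i) \<Longrightarrow> w b \<in> component (d - bdeg P (Suc i) b)"
proof -
  obtain w where w: "w \<in> chains P (Suc i)" "diff P i w = z"
    using assms(1) by (auto simp: cycles_eq_image)
  define w' where "w' = (\<lambda>b. homogeneous_part (d - bdeg P (Suc i) b) (w b))"
  have "diff P i w' b = z b" for b
  proof (cases "b \<in> basis P i")
    case True
    have "homogeneous_part (d - bdeg P i b) (coef P i b c * w c) = coef P i b c * w' c"
      if "c \<in> basis P (Suc i)" for c
      using homogeneous_part_mult[OF coef_component[OF True that], of "d - bdeg P i b" "w c"]
      by (simp add: w'_def)
    then have "diff P i w' b = homogeneous_part (d - bdeg P i b) (diff P i w b)"
      using True by (simp add: diff_def homogeneous_part_sum)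
    then show ?thesis
      using w(2) True assms(2) by (simp add: homogeneous_part_eq)
  qed (use w(2) in \<open>auto simp: diff_def\<close>)
  moreover have "w' \<in> chains P (Suc i)"
    using w(1) by (simp add: chains_def w'_def)
  ultimately show thesis
    using that[of w'] by (auto simp: w'_def homogeneous_part_in_component)
qed

text \<open>Free modules are projective: homogeneous preimages are chosen for the basis vectors of
  the source and extended linearly. The source belongs to a second complex \<open>R\<close>, which
  differs from \<open>P\<close> for comparison maps and equals \<open>P\<close> for
  homotopies.\<close>

lemma lift:
  assumes \<phi>: "graded_map (basis R j) (bdeg R j) (basis P i) (bdeg P i) \<phi>" and C: "finite (basis R j)"
    and cyc: "\<And>v. v \<in> chains R j \<Longrightarrow> \<phi> v \<in> cycles i"
  obtains \<theta> where "graded_map (basis R j) (bdeg R j) (basis P (Suc i)) (bdeg P (Suc i)) \<theta>"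
    "\<And>v. v \<in> chains R j \<Longrightarrow> diff P i (\<theta> v) = \<phi> v"
proof -
  have "\<exists>w. w \<in> chains P (Suc i) \<and> diff P i w = \<phi> (unit_vector c) \<and>
    (\<forall>b\<in>basis P (Suc i). w b \<in> component (bdeg R j c - bdeg P (Suc i) b))" if "c \<in> basis R j" for c
  proof -
    have "\<phi> (unit_vector c) \<in> cycles i"
      using that by (intro cyc) (auto simp: unit_vector_def chains_def)
    then show ?thesis
      using homogeneous_cycle_is_boundary graded_map_unit_vector[OF \<phi> C that] by metis
  qed
  then obtain w where w: "\<And>c. c \<in> basis R j \<Longrightarrow> w c \<in> chains P (Suc i) \<and> diff P i (w c) = \<phi> (unit_vector c) \<and>
      (\<forall>b\<in>basis P (Suc i). w c b \<in> component (bdeg R j c - bdeg P (Suc i) b))"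
    by metis
  have "w c b = 0" if "c \<in> basis R j" "b \<notin> basis P (Suc i)" for c b
    using w[OF that(1)] that(2) by (simp add: chains_def)
  moreover have "w c b \<in> component (bdeg R j c - bdeg P (Suc i) b)" if "c \<in> basis R j" "b \<in> basis P (Suc i)" for c b
    using w[OF that(1)] that(2) by blast
  ultimately obtain \<theta> where \<theta>: "graded_map (basis R j) (bdeg R j) (basis P (Suc i)) (bdeg P (Suc i)) \<theta>"
      "\<And>v. \<theta> v = (\<lambda>b. \<Sum>c\<in>basis R j. v c * w c b)"
    using graded_map_of_columns by blast
  have "diff P i (\<theta> v) = \<phi> v" if "v \<in> chains R j" for v
  proof -
    have "diff P i (\<theta> v) = (\<lambda>b. \<Sum>c\<in>basis R j. v c * diff P i (w c) b)"
      unfolding \<theta>(2) by (rule graded_map_sum[OF graded_map_diff_op])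
    also have "\<dots> = (\<lambda>b. \<Sum>c\<in>basis R j. v c * \<phi> (unit_vector c) b)"
      using w by simp
    also have "\<dots> = \<phi> v"
      using graded_map_expand[OF \<phi> C] that by (simp add: chains_def)
    finally show ?thesis .
  qed
  with \<theta>(1) show thesis by (rule that)
qed

lemma augment_sum:
  "augment P (\<lambda>b. \<Sum>c\<in>C. v c * w c b) = (\<Sum>c\<in>C. lookup (v c) 0 * augment P (w c))"
  unfolding augment_def sum_distrib_left lookup_sum lookup_mult_0 sum_distrib_right
  by (subst sum.swap) (simp only: mult.assoc)

text \<open>Only basis elements of degree 0 are seen by \<open>aug\<close>, and in their entries the
  homogeneous part of degree 0 keeps the constant coefficient.\<close>

lemma homogeneous_augment:
  obtains w where "w \<in> chains P 0" "augment P w = x"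
    "\<And>b. b \<in> basis P 0 \<Longrightarrow> w b \<in> component (- bdeg P 0 b)"
proof -
  have "x \<in> augment P ` chains P 0"
    using res by (simp add: graded_free_resolution_def)
  then obtain w where w: "w \<in> chains P 0" "augment P w = x" by blast
  define w' where "w' = (\<lambda>b. homogeneous_part (- bdeg P 0 b) (w b))"
  have "augment P w' = augment P w"
    unfolding augment_def
  proof (intro sum.cong refl)
    fix b assume "b \<in> basis P 0"
    then show "lookup (w' b) 0 * aug P b = lookup (w b) 0 * aug P b"
      using aug_bdeg[of b] by (cases "aug P b = 0") (auto simp: w'_def lookup_homogeneous_part)
  qed
  moreover have "w' \<in> chains P 0"
    using w(1) by (simp add: chains_def w'_def)
  ultimately show thesis
    using that[of w'] w by (auto simp: w'_def homogeneous_part_in_component)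
qed

end

section \<open>Comparison maps and homotopies between resolutions\<close>

lemma (in resolution) diff_diff: "v \<in> chains P (Suc (Suc i)) \<Longrightarrow> diff P i (diff P (Suc i) v) = (\<lambda>_. 0)"
  using diff_in_cycles[of v "Suc i"] by (simp add: cycles_Suc)

lemma (in resolution) diff_in_chains: "diff P i v \<in> chains P i"
  by (simp add: chains_def diff_def)

lemma graded_map_in_chains:
  "graded_map C dC (basis P i) dB \<phi> \<Longrightarrow> \<phi> v \<in> chains P i"
  by (auto simp: chains_def graded_map_outside)

lemma comparison_map:
  assumes "resolution P" "resolution Q"
  obtains f where "\<And>i. graded_map (basis P i) (bdeg P i) (basis Q i) (bdeg Q i) (f i)"
    "\<And>v. v \<in> chains P 0 \<Longrightarrow> augment Q (f 0 v) = augment P v"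
    "\<And>i v. v \<in> chains P (Suc i) \<Longrightarrow> diff Q i (f (Suc i) v) = f i (diff P i v)"
proof -
  interpret P: resolution P by fact
  interpret Q: resolution Q by fact
  \<comment> \<open>Mapping cycles to cycles is what the next lift needs, so it is carried along;
    the clause for \<open>i = 0\<close> keeps the compatibility with the augmentations.\<close>
  define good where "good = (\<lambda>i \<phi>. graded_map (basis P i) (bdeg P i) (basis Q i) (bdeg Q i) \<phi> \<and>
    (\<forall>v\<in>P.cycles i. \<phi> v \<in> Q.cycles i) \<and>
    (i = 0 \<longrightarrow> (\<forall>v\<in>chains P 0. augment Q (\<phi> v) = augment P v)))"
  have "\<exists>\<phi>. good 0 \<phi>"
  proof -
    have "\<exists>w. w \<in> chains Q 0 \<and> augment Q w = aug P c \<and>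
        (\<forall>b\<in>basis Q 0. w b \<in> component (bdeg P 0 c - bdeg Q 0 b))" if "c \<in> basis P 0" for c
    \<comment> \<open>If \<open>aug P c = 0\<close>, the degree of \<open>c\<close> is
      unconstrained, but the zero vector is homogeneous of every degree. Otherwise \<open>c\<close>
      has degree 0, which is the degree of the homogeneous preimage.\<close>
    proof (cases "aug P c = 0")
      case True
      then show ?thesis
        by (intro exI[of _ "\<lambda>_. 0"]) (auto simp: chains_def augment_def)
    next
      case False
      obtain w where "w \<in> chains Q 0" "augment Q w = aug P c"
          "\<And>b. b \<in> basis Q 0 \<Longrightarrow> w b \<in> component (- bdeg Q 0 b)"
        using Q.homogeneous_augment by blast
      with P.aug_bdeg[OF that False] show ?thesis
        by (intro exI[of _ w]) auto
    qed
    then obtain w where w: "\<And>c. c \<in> basis P 0 \<Longrightarrow> w c \<in> chains Q 0 \<and> augment Q (w c) = aug P c \<and>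
        (\<forall>b\<in>basis Q 0. w c b \<in> component (bdeg P 0 c - bdeg Q 0 b))"
      by metis
    then obtain \<phi> where \<phi>: "graded_map (basis P 0) (bdeg P 0) (basis Q 0) (bdeg Q 0) \<phi>"
        "\<And>v. \<phi> v = (\<lambda>b. \<Sum>c\<in>basis P 0. v c * w c b)"
      using graded_map_of_columns[of "basis P 0" "basis Q 0" w "bdeg P 0" "bdeg Q 0"]
      unfolding chains_def by blast
    have aug: "augment Q (\<phi> v) = augment P v" for v
      using w by (simp add: \<phi>(2) Q.augment_sum) (simp add: augment_def)
    have "\<phi> v \<in> Q.cycles 0" if "v \<in> P.cycles 0" for v
      using that aug graded_map_in_chains[OF \<phi>(1)] by (simp add: P.cycles_0 Q.cycles_0)
    with \<phi>(1) aug show ?thesis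
      unfolding good_def by blast
  qed
  moreover have "\<exists>\<psi>. good (Suc i) \<psi> \<and> (\<forall>v\<in>chains P (Suc i). diff Q i (\<psi> v) = \<phi> (diff P i v))"
    if "good i \<phi>" for i \<phi>
  proof -
    have gr: "graded_map (basis P i) (bdeg P i) (basis Q i) (bdeg Q i) \<phi>"
      and cyc: "\<And>v. v \<in> P.cycles i \<Longrightarrow> \<phi> v \<in> Q.cycles i"
      using that by (auto simp: good_def)
    have "graded_map (basis P (Suc i)) (bdeg P (Suc i)) (basis Q i) (bdeg Q i) (\<lambda>v. \<phi> (diff P i v))"
      by (rule graded_map_comp[OF P.graded_map_diff_op gr]) simp_all
    moreover have "\<phi> (diff P i v) \<in> Q.cycles i" if "v \<in> chains P (Suc i)" for v
      using that by (intro cyc P.diff_in_cycles)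
    ultimately obtain \<psi> where \<psi>: "graded_map (basis P (Suc i)) (bdeg P (Suc i)) (basis Q (Suc i)) (bdeg Q (Suc i)) \<psi>"
      and comm: "\<And>v. v \<in> chains P (Suc i) \<Longrightarrow> diff Q i (\<psi> v) = \<phi> (diff P i v)"
      using Q.lift[of P "Suc i" i "\<lambda>v. \<phi> (diff P i v)"] P.finite_basis by blast
    have "\<psi> v \<in> Q.cycles (Suc i)" if "v \<in> P.cycles (Suc i)" for v
      using that graded_map_in_chains[OF \<psi>] comm[of v] graded_map_0[OF gr]
      by (simp add: P.cycles_Suc Q.cycles_Suc)
    with \<psi> comm show ?thesis
      unfolding good_def by blast
  qed
  ultimately obtain f where f: "\<And>i. good i (f i)"
      "\<And>i v. v \<in> chains P (Suc i) \<Longrightarrow> diff Q i (f (Suc i) v) = f i (diff P i v)"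
    using dependent_nat_choice[of good "\<lambda>i \<phi> \<psi>. \<forall>v\<in>chains P (Suc i). diff Q i (\<psi> v) = \<phi> (diff P i v)"]
    by blast
  show thesis
    by (rule that[OF _ _ f(2)]) (use f(1) in \<open>auto simp: good_def\<close>)
qed

text \<open>The homotopy is built by lifting \<open>\<phi> - h d\<close>. Its values are cycles: on
  boundaries \<open>d h\<close> agrees with \<open>\<phi>\<close> because \<open>d d = 0\<close>, so
  \<open>d \<phi> - d h d = d \<phi> - \<phi> d = 0\<close>.\<close>

lemma (in resolution) null_homotopy:
  assumes gr: "\<And>i. graded_map (basis P i) (bdeg P i) (basis P i) (bdeg P i) (\<phi> i)"
    and aug: "\<And>v. v \<in> chains P 0 \<Longrightarrow> augment P (\<phi> 0 v) = 0"
    and comm: "\<And>i v. v \<in> chains P (Suc i) \<Longrightarrow> diff P i (\<phi> (Suc i) v) = \<phi> i (diff P i v)"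
  obtains h where
    "\<And>i. graded_map (basis P i) (bdeg P i) (basis P (Suc i)) (bdeg P (Suc i)) (h i)"
    "\<And>v. v \<in> chains P 0 \<Longrightarrow> diff P 0 (h 0 v) = \<phi> 0 v"
    "\<And>i v. v \<in> chains P (Suc i) \<Longrightarrow>
       diff P (Suc i) (h (Suc i) v) = (\<lambda>b. \<phi> (Suc i) v b - h i (diff P i v) b)"
proof -
  define good where "good = (\<lambda>i h. graded_map (basis P i) (bdeg P i) (basis P (Suc i)) (bdeg P (Suc i)) h \<and>
    (\<forall>v\<in>chains P (Suc i). (\<lambda>b. \<phi> (Suc i) v b - h (diff P i v) b) \<in> cycles (Suc i)) \<and>
    (i = 0 \<longrightarrow> (\<forall>v\<in>chains P 0. diff P 0 (h v) = \<phi> 0 v)))"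
  have *: "(\<lambda>b. \<phi> (Suc i) v b - h (diff P i v) b) \<in> cycles (Suc i)"
    if h: "graded_map (basis P i) (bdeg P i) (basis P (Suc i)) (bdeg P (Suc i)) h"
      and d: "diff P i (h (diff P i v)) = \<phi> i (diff P i v)" and v: "v \<in> chains P (Suc i)" for i h v
    using graded_map_in_chains[OF gr[of "Suc i"]] graded_map_in_chains[OF h] comm[OF v] d
    by (auto simp: cycles_Suc graded_map_diff[OF graded_map_diff_op]) (auto simp: chains_def)
  have "\<exists>h. good 0 h"
  proof -
    have "\<phi> 0 v \<in> cycles 0" if "v \<in> chains P 0" for v
      using aug[of v] that graded_map_in_chains[OF gr[of 0]] by (simp add: cycles_0)
    then obtain h where h: "graded_map (basis P 0) (bdeg P 0) (basis P (Suc 0)) (bdeg P (Suc 0)) h"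
        "\<And>v. v \<in> chains P 0 \<Longrightarrow> diff P 0 (h v) = \<phi> 0 v"
      using lift[OF gr[of 0] finite_basis] by blast
    have "good 0 h"
      unfolding good_def by (intro conjI ballI impI *[OF h(1)] h diff_in_chains)
    then show ?thesis by blast
  qed
  moreover have "\<exists>h'. good (Suc i) h' \<and> (\<forall>v\<in>chains P (Suc i).
      diff P (Suc i) (h' v) = (\<lambda>b. \<phi> (Suc i) v b - h (diff P i v) b))" if "good i h" for i h
  proof -
    have h: "graded_map (basis P i) (bdeg P i) (basis P (Suc i)) (bdeg P (Suc i)) h"
      and cyc: "\<And>v. v \<in> chains P (Suc i) \<Longrightarrow> (\<lambda>b. \<phi> (Suc i) v b - h (diff P i v) b) \<in> cycles (Suc i)"
      using that by (auto simp: good_def)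
    have "graded_map (basis P (Suc i)) (bdeg P (Suc i)) (basis P (Suc i)) (bdeg P (Suc i))
        (\<lambda>v b. \<phi> (Suc i) v b - h (diff P i v) b)"
      by (rule graded_map_minus[OF gr graded_map_comp[OF graded_map_diff_op h]]) simp_all
    from lift[OF this finite_basis cyc] obtain h' where
      h': "graded_map (basis P (Suc i)) (bdeg P (Suc i)) (basis P (Suc (Suc i))) (bdeg P (Suc (Suc i))) h'"
        "\<And>v. v \<in> chains P (Suc i) \<Longrightarrow> diff P (Suc i) (h' v) = (\<lambda>b. \<phi> (Suc i) v b - h (diff P i v) b)"
      by blast
    have "good (Suc i) h'"
      unfolding good_def
    proof (intro conjI ballI)
      fix v assume v: "v \<in> chains P (Suc (Suc i))"
      have "diff P (Suc i) (h' (diff P (Suc i) v)) = \<phi> (Suc i) (diff P (Suc i) v)"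
        using h'(2)[OF diff_in_chains] diff_diff[OF v] graded_map_0[OF h] by simp
      with h'(1) v show "(\<lambda>b. \<phi> (Suc (Suc i)) v b - h' (diff P (Suc i) v) b) \<in> cycles (Suc (Suc i))"
        by (intro *)
    qed (use h' in auto)
    with h'(2) show ?thesis by blast
  qed
  ultimately obtain h where h: "\<And>i. good i (h i)"
      "\<And>i v. v \<in> chains P (Suc i) \<Longrightarrow>
         diff P (Suc i) (h (Suc i) v) = (\<lambda>b. \<phi> (Suc i) v b - h i (diff P i v) b)"
    using dependent_nat_choice[of good "\<lambda>i h h'. \<forall>v\<in>chains P (Suc i).
      diff P (Suc i) (h' v) = (\<lambda>b. \<phi> (Suc i) v b - h (diff P i v) b)"]
    by blast
  show thesis
    by (rule that[OF _ _ h(2)]) (use h(1) in \<open>auto simp: good_def\<close>)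
qed

text \<open>Tensoring with \<open>J\<close> leaves the matrix of a map unchanged: it acts on
  families with entries in \<open>J\<close>, the ideal absorbs the matrix entries, and the degrees
  add up.\<close>

lemma graded_map_tensor_component:
  assumes J: "ideal.subspace J"
    and \<phi>: "graded_map (basis P i) (bdeg P i) (basis Q j) (bdeg Q j) \<phi>"
    and v: "v \<in> tensor_component P i J d"
  shows "\<phi> v \<in> tensor_component Q j J d"
proof -
  obtain f where f: "\<And>b c. b \<in> basis Q j \<Longrightarrow> c \<in> basis P i \<Longrightarrow> f b c \<in> component (bdeg P i c - bdeg Q j b)"
      "\<phi> = matrix_map (basis P i) (basis Q j) f"
    using \<phi> by (auto simp: graded_map_def)
  have "\<phi> v b \<in> J \<inter> component (d - bdeg Q j b)" if "b \<in> basis Q j" for b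
  proof -
    have "f b c * v c \<in> J" "f b c * v c \<in> component (d - bdeg Q j b)" if "c \<in> basis P i" for c
    proof -
      have vc: "v c \<in> J" "v c \<in> component (d - bdeg P i c)"
        using v that by (auto simp: tensor_component_def)
      show "f b c * v c \<in> J"
        by (rule ideal.subspace_scale[OF J vc(1)])
      show "f b c * v c \<in> component (d - bdeg Q j b)"
        using component_mult'[OF vc(2) f(1)[OF \<open>b \<in> basis Q j\<close> that]] by (simp add: mult.commute)
    qed
    then have "(\<Sum>c\<in>basis P i. f b c * v c) \<in> J \<inter> component (d - bdeg Q j b)"
      by (intro IntI component_sum ideal.subspace_sum[OF J]) auto
    with that show ?thesis
      by (simp add: f(2) matrix_map_def)
  qed
  then show ?thesis
    using graded_map_in_chains[OF \<phi>] by (simp add: tensor_component_def)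
qed

lemma tensor_component_add:
  assumes "ideal.subspace J" "v \<in> tensor_component P i J d" "w \<in> tensor_component P i J d"
  shows "(\<lambda>b. v b + w b) \<in> tensor_component P i J d"
  using assms by (auto simp: tensor_component_def chains_def component_add ideal.subspace_add)

lemma tensor_component_diff:
  assumes "ideal.subspace J" "v \<in> tensor_component P i J d" "w \<in> tensor_component P i J d"
  shows "(\<lambda>b. v b - w b) \<in> tensor_component P i J d"
  using assms by (auto simp: tensor_component_def chains_def component_diff ideal.subspace_diff)

lemma tensor_component_0: "ideal.subspace J \<Longrightarrow> (\<lambda>_. 0) \<in> tensor_component P i J d"
  by (auto simp: tensor_component_def chains_def ideal.subspace_0)

lemma tensor_cycles_subset_component: "tensor_cycles P i J d \<subseteq> tensor_component P i J d"
  by (cases i) auto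

text \<open>If \<open>f : P \<rightarrow> Q\<close> and \<open>g : Q \<rightarrow> P\<close> lift the identity of \<open>K\<close>, then \<open>1 - g f = d h + h d\<close>, and this
  persists after tensoring with \<open>J\<close>.\<close>

lemma tensor_exact_transfer:
  assumes "resolution P" "resolution Q" and J: "ideal.subspace J"
    and exact: "tensor_cycles Q i J d \<subseteq> tensor_boundaries Q i J d"
  shows "tensor_cycles P i J d \<subseteq> tensor_boundaries P i J d"
proof
  interpret P: resolution P by fact
  interpret Q: resolution Q by fact
  obtain f where f: "\<And>i. graded_map (basis P i) (bdeg P i) (basis Q i) (bdeg Q i) (f i)"
      "\<And>v. v \<in> chains P 0 \<Longrightarrow> augment Q (f 0 v) = augment P v"
      "\<And>i v. v \<in> chains P (Suc i) \<Longrightarrow> diff Q i (f (Suc i) v) = f i (diff P i v)"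
    using comparison_map[OF assms(1,2)] by blast
  obtain g where g: "\<And>i. graded_map (basis Q i) (bdeg Q i) (basis P i) (bdeg P i) (g i)"
      "\<And>v. v \<in> chains Q 0 \<Longrightarrow> augment P (g 0 v) = augment Q v"
      "\<And>i v. v \<in> chains Q (Suc i) \<Longrightarrow> diff P i (g (Suc i) v) = g i (diff Q i v)"
    using comparison_map[OF assms(2,1)] by blast
  define \<phi> where "\<phi> i v = (\<lambda>b. restrict_zero (basis P i) v b - g i (f i v) b)" for i v
  have restrict: "restrict_zero (basis P i) v = v" if "v \<in> chains P i" for i v
    using that by (auto simp: restrict_zero_def chains_def)
  have \<phi>: "\<phi> i v = (\<lambda>b. v b - g i (f i v) b)" if "v \<in> chains P i" for i v
    using that by (simp add: \<phi>_def restrict)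
  have f_chains: "f i v \<in> chains Q i" for i v
    by (rule graded_map_in_chains[OF f(1)])
  have gr: "graded_map (basis P i) (bdeg P i) (basis P i) (bdeg P i) (\<phi> i)" for i
    unfolding \<phi>_def
    by (intro graded_map_minus graded_map_restrict_zero graded_map_comp[OF f(1) g(1)]) simp_all
  have aug: "augment P (\<phi> 0 v) = 0" if "v \<in> chains P 0" for v
  proof -
    have "augment P (g 0 (f 0 v)) = augment P v"
      using that f(2) g(2) f_chains by simp
    then show ?thesis
      using that by (simp add: \<phi> augment_def lookup_minus left_diff_distrib sum_subtractf)
  qed
  have comm: "diff P i (\<phi> (Suc i) v) = \<phi> i (diff P i v)" if "v \<in> chains P (Suc i)" for i v
    using that f(3) g(3) f_chains P.diff_in_chains
    by (simp add: \<phi> graded_map_diff[OF P.graded_map_diff_op])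
  obtain h where h:
    "\<And>i. graded_map (basis P i) (bdeg P i) (basis P (Suc i)) (bdeg P (Suc i)) (h i)"
    "\<And>v. v \<in> chains P 0 \<Longrightarrow> diff P 0 (h 0 v) = \<phi> 0 v"
    "\<And>i v. v \<in> chains P (Suc i) \<Longrightarrow>
       diff P (Suc i) (h (Suc i) v) = (\<lambda>b. \<phi> (Suc i) v b - h i (diff P i v) b)"
    using P.null_homotopy[of \<phi>, OF gr aug comm] by blast
  fix v assume v: "v \<in> tensor_cycles P i J d"
  then have v_comp: "v \<in> tensor_component P i J d" and v_chain: "v \<in> chains P i"
    using tensor_cycles_subset_component[of P i J d] by (auto simp: tensor_component_def)
  have hv: "diff P i (h i v) = \<phi> i v"
  proof (cases i)
    case (Suc j)
    then have "diff P j v = (\<lambda>_. 0)" using v by simp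
    then show ?thesis
      using h(3)[of v j] v_chain Suc graded_map_0[OF h(1)] by simp
  qed (use h(2) v_chain in simp)
  have "f i v \<in> tensor_cycles Q i J d"
  proof (cases i)
    case (Suc j)
    then have "diff P j v = (\<lambda>_. 0)" using v by simp
    then show ?thesis
      using graded_map_tensor_component[OF J f(1) v_comp] f(3)[of v j] v_chain Suc graded_map_0[OF f(1)]
      by simp
  qed (use graded_map_tensor_component[OF J f(1) v_comp] in simp)
  with exact obtain w where w: "w \<in> tensor_component Q (Suc i) J d" "f i v = diff Q i w"
    by (auto simp: tensor_boundaries_def)
  have "diff P i (g (Suc i) w) = g i (f i v)"
    using w g(3) by (simp add: tensor_component_def)
  \<comment> \<open>As \<open>v\<close> is a cycle, \<open>v = g f v + d h v\<close>, and exactness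
    over \<open>Q\<close> turns \<open>g f v\<close> into \<open>g d w = d g w\<close>.\<close>
  then have "diff P i (\<lambda>b. g (Suc i) w b + h i v b) = v"
    by (simp add: graded_map_add[OF P.graded_map_diff_op] hv \<phi>[OF v_chain])
  moreover have "(\<lambda>b. g (Suc i) w b + h i v b) \<in> tensor_component P (Suc i) J d"
    by (intro tensor_component_add J graded_map_tensor_component[OF J g(1) w(1)]
        graded_map_tensor_component[OF J h(1) v_comp])
  ultimately show "v \<in> tensor_boundaries P i J d"
    unfolding tensor_boundaries_def by (intro image_eqI[OF sym])
qed

text \<open>The existence of \<open>Q\<close> guarantees that the chosen resolution really is one;
  transfer of exactness in both directions then puts \<open>Q\<close> in its place. The boundaries
  form the zero class, so Tor vanishes when every cycle is a boundary.\<close>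

lemma Tor_nonzero_iff:
  fixes Q :: "('n::finite, 'k::field) free_complex"
  assumes Q: "graded_free_resolution Q" and J: "ideal.subspace J"
  shows "Tor_nonzero i J d \<longleftrightarrow> \<not> tensor_cycles Q i J d \<subseteq> tensor_boundaries Q i J d"
proof -
  define P :: "('n, 'k) free_complex" where "P = residue_field_resolution"
  have "graded_free_resolution P"
    unfolding P_def residue_field_resolution_def using Q by (rule someI)
  then have res: "resolution P" "resolution Q"
    using Q by (auto simp: resolution_def)
  interpret P: resolution P by fact
  let ?Z = "tensor_cycles P i J d" and ?B = "tensor_boundaries P i J d"
  let ?R = "{(v, w). (\<lambda>b. w b - v b) \<in> ?B}"
  have B0: "(\<lambda>_. 0) \<in> ?B"
    unfolding tensor_boundaries_def
    using graded_map_0[OF P.graded_map_diff_op] tensor_component_0[OF J]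
    by (intro image_eqI[of _ _ "\<lambda>_. 0"]) auto
  have add: "(\<lambda>b. v b + w b) \<in> ?B" if "v \<in> ?B" "w \<in> ?B" for v w
    using that unfolding tensor_boundaries_def
    by (auto simp flip: graded_map_add[OF P.graded_map_diff_op] intro!: imageI tensor_component_add[OF J])
  have diff: "(\<lambda>b. v b - w b) \<in> ?B" if "v \<in> ?B" "w \<in> ?B" for v w
    using that unfolding tensor_boundaries_def
    by (auto simp flip: graded_map_diff[OF P.graded_map_diff_op] intro!: imageI tensor_component_diff[OF J])
  have Z0: "(\<lambda>_. 0) \<in> ?Z"
    using tensor_component_0[OF J] graded_map_0[OF P.graded_map_diff_op] by (cases i) auto
  have class_eq: "?R `` {v} = ?B" if "v \<in> ?B" for v
  proof (intro subset_antisym subsetI)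
    fix w assume "w \<in> ?R `` {v}"
    then show "w \<in> ?B" using add[of v "\<lambda>b. w b - v b"] that by simp
  qed (use diff that in auto)
  have "Tor i J d = {?B} \<longleftrightarrow> ?Z \<subseteq> ?B"
  proof
    assume *: "Tor i J d = {?B}"
    show "?Z \<subseteq> ?B"
    proof
      fix v assume "v \<in> ?Z"
      then have "?R `` {v} \<in> Tor i J d"
        unfolding Tor_def Let_def P_def[symmetric] by (rule quotientI)
      moreover have "v \<in> ?R `` {v}" using B0 by simp
      ultimately show "v \<in> ?B" using * by blast
    qed
  next
    assume "?Z \<subseteq> ?B"
    then have "(\<lambda>v. ?R `` {v}) ` ?Z = {?B}"
      using class_eq Z0 by blast
    then show "Tor i J d = {?B}"
      unfolding Tor_def Let_def P_def[symmetric] quotient_def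
      by (simp only: UNION_singleton_eq_range)
  qed
  also have "?Z \<subseteq> ?B \<longleftrightarrow> tensor_cycles Q i J d \<subseteq> tensor_boundaries Q i J d"
    using tensor_exact_transfer[OF res J] tensor_exact_transfer[OF res(2,1) J] by blast
  finally show ?thesis
    unfolding Tor_nonzero_def P_def by simp
qed

section \<open>The Koszul complex\<close>

definition ksign :: "'n::{finite, linorder} \<Rightarrow> 'n set \<Rightarrow> 'k::field" where
  "ksign j G = (- 1) ^ card {g \<in> G. g < j}"

lemma ksign_insert:
  assumes "m \<notin> G"
  shows "ksign j (insert m G) = (if m < j then - ksign j G else ksign j G)"
proof -
  have "{g \<in> insert m G. g < j} = (if m < j then insert m {g \<in> G. g < j} else {g \<in> G. g < j})"
    by auto
  with assms show ?thesis
    by (simp add: ksign_def)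
qed

lemma ksign_square: "ksign j G * ksign j G = (1 :: 'k::field)"
  by (simp add: ksign_def flip: power_mult_distrib)

lemma ksign_nonzero: "ksign j G \<noteq> (0 :: 'k::field)"
  by (simp add: ksign_def)

text \<open>\<open>ksign j G\<close> is the sign picked up by moving \<open>e_j\<close> past the
  smaller elements of \<open>G\<close>; the two orders of inserting \<open>j\<close> and
  \<open>m\<close> differ by one transposition.\<close>

lemma ksign_swap:
  assumes "j \<noteq> m" "j \<notin> G" "m \<notin> G"
  shows "ksign j G * ksign m (insert j G) = - (ksign m G * ksign j (insert m G) :: 'k::field)"
  using assms by (auto simp: ksign_insert)

text \<open>A chain is given by its coefficients, and the boundary at \<open>G\<close> collects
  those of the sets with one more vertex. The empty set counts as a face, so this is the augmented
  complex.\<close>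

definition simplex_boundary :: "('n::{finite, linorder} set \<Rightarrow> 'k::field) \<Rightarrow> 'n set \<Rightarrow> 'k" where
  "simplex_boundary c G = (\<Sum>j\<in>-G. ksign j G * c (insert j G))"

definition cone :: "'n::{finite, linorder} \<Rightarrow> ('n set \<Rightarrow> 'k::field) \<Rightarrow> 'n set \<Rightarrow> 'k" where
  "cone m c F = (if m \<in> F then ksign m (F - {m}) * c (F - {m}) else 0)"

lemma simplex_boundary_0 [simp]: "simplex_boundary (\<lambda>_. 0) = (\<lambda>_. 0)"
  by (simp add: simplex_boundary_def fun_eq_iff)

lemma simplex_boundary_simplex_boundary:
  fixes c :: "'n::{finite, linorder} set \<Rightarrow> 'k::field"
  shows "simplex_boundary (simplex_boundary c) = (\<lambda>_. 0)"
proof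
  fix G :: "'n set"
  define T where "T j l = ksign j G * (ksign l (insert j G) * c (insert l (insert j G)))" for j l
  have T: "T l j = - T j l" if "j \<notin> G" "l \<notin> G" "j < l" for j l
  proof -
    have "ksign l G * ksign j (insert l G) = - (ksign j G * ksign l (insert j G) :: 'k)"
      using that by (intro ksign_swap) auto
    then show ?thesis
      by (simp add: T_def insert_commute flip: mult.assoc)
  qed
  let ?S = "{(j, l). j \<notin> G \<and> l \<notin> G \<and> j < l}"
  have "simplex_boundary (simplex_boundary c) G = (\<Sum>j\<in>-G. \<Sum>l\<in>-insert j G. T j l)"
    by (simp add: simplex_boundary_def T_def sum_distrib_left)
  also have "\<dots> = (\<Sum>(j, l)\<in>(SIGMA j:-G. -insert j G). T j l)"
    by (simp add: sum.Sigma)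
  \<comment> \<open>Each pair of vertices occurs in both orders, and the two terms have opposite
    signs.\<close>
  also have "(SIGMA j:-G. -insert j G) = ?S \<union> prod.swap ` ?S"
    by (auto simp: image_iff)
  also have "(\<Sum>(j, l)\<in>?S \<union> prod.swap ` ?S. T j l) = (\<Sum>(j, l)\<in>?S. T j l) + (\<Sum>(j, l)\<in>prod.swap ` ?S. T j l)"
    by (rule sum.union_disjoint) auto
  also have "(\<Sum>(j, l)\<in>prod.swap ` ?S. T j l) = (\<Sum>(j, l)\<in>?S. T l j)"
    by (subst sum.reindex) (auto simp: case_prod_unfold)
  also have "\<dots> = (\<Sum>(j, l)\<in>?S. - T j l)"
    by (rule sum.cong) (auto intro: T)
  finally show "simplex_boundary (simplex_boundary c) G = 0"
    by (simp add: sum_negf case_prod_unfold)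
qed

text \<open>For \<open>m \<notin> G\<close> only the term \<open>j = m\<close> survives. For
  \<open>m \<in> G\<close> the terms of the two summands cancel by anticommutativity, except for the
  one that removes \<open>m\<close> and inserts it again, which is \<open>c G\<close>.\<close>

lemma cone_homotopy:
  "simplex_boundary (cone m c) G + cone m (simplex_boundary c) G = (c G :: 'k::field)"
proof (cases "m \<in> G")
  case False
  have "simplex_boundary (cone m c) G = (\<Sum>j\<in>-G. if j = m then c G else 0)"
    unfolding simplex_boundary_def
    by (rule sum.cong) (use False ksign_square[of m G] in \<open>auto simp: cone_def simp flip: mult.assoc\<close>)
  with False show ?thesis
    by (simp add: cone_def)
next
  case True
  define H where "H = G - {m}"
  have G: "G = insert m H" and H: "m \<notin> H"
    using True by (auto simp: H_def)
  have "simplex_boundary (cone m c) G =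
      (\<Sum>j\<in>-G. ksign j (insert m H) * (ksign m (insert j H) * c (insert j H)))"
    unfolding simplex_boundary_def
    by (rule sum.cong) (auto simp: cone_def G H insert_Diff_if)
  also have "\<dots> = (\<Sum>j\<in>-G. - (ksign m H * ksign j H * c (insert j H)))"
  proof (rule sum.cong)
    fix j assume "j \<in> - G"
    then have "ksign j (insert m H) * ksign m (insert j H) = - (ksign m H * ksign j H :: 'k)"
      using H by (auto simp: G ksign_insert)
    then show "ksign j (insert m H) * (ksign m (insert j H) * c (insert j H)) =
        - (ksign m H * ksign j H * c (insert j H))"
      by (simp flip: mult.assoc)
  qed simp
  also have "\<dots> = - (ksign m H * (\<Sum>j\<in>-G. ksign j H * c (insert j H)))"
    by (simp add: sum_negf sum_distrib_left mult.assoc)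
  finally have 1: "simplex_boundary (cone m c) G = - (ksign m H * (\<Sum>j\<in>-G. ksign j H * c (insert j H)))" .
  have "- H = insert m (- G)"
    using H by (auto simp: G)
  then have "simplex_boundary c H = ksign m H * c G + (\<Sum>j\<in>-G. ksign j H * c (insert j H))"
    using True by (simp add: simplex_boundary_def G)
  then have "cone m (simplex_boundary c) G =
      ksign m H * (ksign m H * c G + (\<Sum>j\<in>-G. ksign j H * c (insert j H)))"
    using True by (simp add: cone_def H_def)
  also have "\<dots> = c G + ksign m H * (\<Sum>j\<in>-G. ksign j H * c (insert j H))"
    using ksign_square[of m H, where 'k = 'k] by (simp add: distrib_left flip: mult.assoc)
  finally show ?thesis
    using 1 by simp
qed

lemma simplex_boundary_cone:
  assumes "simplex_boundary c = (\<lambda>_. 0)"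
  shows "simplex_boundary (cone m c) = c"
proof
  fix G
  have "cone m (simplex_boundary c) G = 0"
    by (simp add: assms cone_def)
  with cone_homotopy[of m c G] show "simplex_boundary (cone m c) G = c G"
    by simp
qed

section \<open>The Koszul differential in a single multidegree\<close>

definition squarefree :: "'n set \<Rightarrow> 'n::finite monom" where
  "squarefree F = (\<Sum>j\<in>F. single j 1)"

lemma squarefree_empty [simp]: "squarefree {} = 0"
  by (simp add: squarefree_def)

lemma squarefree_insert: "j \<notin> F \<Longrightarrow> squarefree (insert j F) = single j 1 + squarefree F"
  by (simp add: squarefree_def)

lemma lookup_squarefree: "lookup (squarefree F) j = (if j \<in> F then 1 else 0)"
  by (simp add: squarefree_def lookup_sum lookup_single when_def)

lemma split_variable:
  fixes t :: "'n monom"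
  assumes "j \<in> keys t"
  obtains s where "t = s + single j 1"
proof
  show "t = (t - single j 1) + single j 1"
    using assms
    by (intro poly_mapping_eqI) (auto simp: lookup_add lookup_minus lookup_single when_def in_keys_iff)
qed

text \<open>The Koszul differential on families indexed by all sets of variables, the index \<open>F\<close> standing
  for the exterior monomial on \<open>F\<close>. In multidegree \<open>a\<close> it is the boundary operator of a simplex.\<close>

definition koszul_diff :: "('n::{finite, linorder} set \<Rightarrow> ('n, 'k::field) mpoly) \<Rightarrow> 'n set \<Rightarrow> ('n, 'k) mpoly" where
  "koszul_diff v G = (\<Sum>j\<in>-G. single (single j 1) (ksign j G) * v (insert j G))"

text \<open>The exterior monomial on \<open>F\<close> has degree \<open>squarefree F\<close>, so
  this is the part of \<open>v F\<close> in multidegree \<open>a\<close>. It is 0 where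
  \<open>x_F\<close> does not divide \<open>x^a\<close>, since the truncated difference would read
  off an unrelated coefficient there.\<close>

definition coeff_at :: "('n::{finite, linorder} set \<Rightarrow> ('n, 'k::field) mpoly) \<Rightarrow> 'n monom \<Rightarrow> 'n set \<Rightarrow> 'k" where
  "coeff_at v a F = (if \<exists>s. a = s + squarefree F then lookup (v F) (a - squarefree F) else 0)"

lemma coeff_at_add: "coeff_at v (t + squarefree F) F = lookup (v F) t"
  by (auto simp: coeff_at_def)

lemma coeff_at_eqD:
  assumes "\<And>a. coeff_at v a = coeff_at w a"
  shows "v = w"
proof (intro ext poly_mapping_eqI)
  fix F t show "lookup (v F) t = lookup (w F) t"
    using assms[of "t + squarefree F"] by (simp add: coeff_at_add[symmetric])
qed

lemma coeff_at_0 [simp]: "coeff_at (\<lambda>_. 0) a = (\<lambda>_. 0)"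
  by (simp add: coeff_at_def fun_eq_iff)

text \<open>Multiplication by \<open>x_j\<close> makes up for the removal of \<open>j\<close> from
  the index set, so the multidegree is preserved and only the signs remain.\<close>

lemma coeff_at_koszul_diff: "coeff_at (koszul_diff v) a = simplex_boundary (coeff_at v a)"
proof
  fix G
  show "coeff_at (koszul_diff v) a G = simplex_boundary (coeff_at v a) G"
  proof (cases "\<exists>s. a = s + squarefree G")
    case True
    then obtain s where s: "a = s + squarefree G" by blast
    have "lookup (single (single j 1) (ksign j G) * v (insert j G)) s = ksign j G * coeff_at v a (insert j G)"
      if "j \<in> - G" for j
    proof (cases "\<exists>r. s = single j 1 + r")
      case True
      then obtain r where r: "s = single j 1 + r" by blast
      then have "a = r + squarefree (insert j G)"
        using that by (simp add: s squarefree_insert ac_simps)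
      with r show ?thesis
        by (auto simp: coeff_at_add lookup_single_mult)
    next
      case False
      have "\<not> (\<exists>r. a = r + squarefree (insert j G))"
      proof
        assume "\<exists>r. a = r + squarefree (insert j G)"
        then obtain r where "a = r + squarefree (insert j G)" by blast
        then have "s + squarefree G = (single j 1 + r) + squarefree G"
          using that by (simp add: s squarefree_insert ac_simps)
        with False show False by (simp only: add_right_cancel) blast
      qed
      with False show ?thesis
        by (simp add: coeff_at_def lookup_single_mult)
    qed
    then have "lookup (koszul_diff v G) s = simplex_boundary (coeff_at v a) G"
      by (simp add: koszul_diff_def simplex_boundary_def lookup_sum)
    then show ?thesis
      by (simp add: s coeff_at_add)
  next
    case False
    have "\<not> (\<exists>r. a = r + squarefree (insert j G))" if "j \<in> - G" for j
    proof
      assume "\<exists>r. a = r + squarefree (insert j G)"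
      then obtain r where "a = r + squarefree (insert j G)" by blast
      then have "a = (r + single j 1) + squarefree G"
        using that by (simp add: squarefree_insert ac_simps)
      with False show False by blast
    qed
    with False show ?thesis
      by (simp add: coeff_at_def simplex_boundary_def)
  qed
qed

text \<open>In a multidegree \<open>a \<noteq> 0\<close> the complex is contracted by the cone over a variable dividing \<open>a\<close>.\<close>

lemma koszul_exact:
  assumes supp: "\<And>F. card F \<noteq> i \<Longrightarrow> v F = 0" and closed: "koszul_diff v = (\<lambda>_. 0)"
    and const: "i = 0 \<Longrightarrow> lookup (v {}) 0 = 0"
  obtains u where "\<And>F. card F \<noteq> Suc i \<Longrightarrow> u F = 0" "koszul_diff u = v"
proof -
  \<comment> \<open>The variable may depend on the degree in an arbitrary way, since each degree is
    contracted separately.\<close>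
  define m :: "'a monom \<Rightarrow> 'a" where "m a = (SOME j. j \<in> keys a)" for a
  have m: "m a \<in> keys a" if "a \<noteq> 0" for a
    unfolding m_def by (rule someI_ex) (use that in \<open>simp add: ex_in_conv\<close>)
  have bd: "simplex_boundary (coeff_at v a) = (\<lambda>_. 0)" for a
    using closed by (simp flip: coeff_at_koszul_diff)
  define g where "g F t = cone (m (t + squarefree F)) (coeff_at v (t + squarefree F)) F" for F t
  \<comment> \<open>The preimage is prescribed degree by degree, so it must be checked to consist of
    polynomials. A nonzero coefficient at \<open>t\<close> comes from a term of some
    \<open>v (F - {j})\<close> at \<open>t + single j 1\<close>, and there are finitely many of
    those.\<close>
  have "finite {t. g F t \<noteq> 0}" for F
  proof (rule finite_subset)
    show "{t. g F t \<noteq> 0} \<subseteq> (\<Union>j\<in>F. (\<lambda>s. s - single j 1) ` keys (v (F - {j})))"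
    proof
      fix t assume "t \<in> {t. g F t \<noteq> 0}"
      then obtain j where j: "j \<in> F" "coeff_at v (t + squarefree F) (F - {j}) \<noteq> 0"
        by (auto simp: g_def cone_def split: if_splits)
      then have "squarefree F = single j 1 + squarefree (F - {j})"
        using squarefree_insert[of j "F - {j}"] by (simp add: insert_absorb)
      then have "t + squarefree F = (t + single j 1) + squarefree (F - {j})"
        by (simp add: add.assoc)
      with j(2) have "t + single j 1 \<in> keys (v (F - {j}))"
        by (simp add: coeff_at_add in_keys_iff)
      then show "t \<in> (\<Union>j\<in>F. (\<lambda>s. s - single j 1) ` keys (v (F - {j})))"
        using j(1) by (auto intro!: bexI[of _ j] image_eqI[of _ _ "t + single j 1"])
    qed
  qed auto
  then have lookup_u: "lookup (Abs_poly_mapping (g F)) t = g F t" for F t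
    by (simp add: lookup_Abs_poly_mapping)
  define u where "u F = Abs_poly_mapping (g F)" for F
  have coeff_u: "coeff_at u a = cone (m a) (coeff_at v a)" if "a \<noteq> 0" for a
  proof
    fix F show "coeff_at u a F = cone (m a) (coeff_at v a) F"
    proof (cases "\<exists>s. a = s + squarefree F")
      case True
      then show ?thesis by (auto simp: coeff_at_add u_def lookup_u g_def)
    next
      case False
      have "\<not> (\<exists>s. a = s + squarefree (F - {m a}))" if ma: "m a \<in> F"
      proof
        assume "\<exists>s. a = s + squarefree (F - {m a})"
        then obtain s where s: "a = s + squarefree (F - {m a})" by blast
        have "m a \<in> keys s"
          using m[OF \<open>a \<noteq> 0\<close>] arg_cong[OF s, of "\<lambda>t. lookup t (m a)"]
          by (simp add: in_keys_iff lookup_add lookup_squarefree)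
        then obtain r where r: "s = r + single (m a) 1"
          by (rule split_variable)
        have "squarefree (insert (m a) (F - {m a})) = single (m a) 1 + squarefree (F - {m a})"
          by (rule squarefree_insert) simp
        then have F: "squarefree F = single (m a) 1 + squarefree (F - {m a})"
          using ma by (simp add: insert_absorb)
        have "a = (r + single (m a) 1) + squarefree (F - {m a})"
          using s unfolding r .
        also have "\<dots> = r + squarefree F"
          unfolding F by (rule add.assoc)
        finally show False using False by blast
      qed
      with False show ?thesis by (simp add: coeff_at_def cone_def)
    qed
  qed
  have coeff_0: "coeff_at w 0 F = (if F = {} then lookup (w {}) 0 else 0)" for F and w :: "'a set \<Rightarrow> ('a, 'b) mpoly"
  proof (cases "F = {}")
    case False
    then obtain j where "j \<in> F" by blast
    then have "0 \<noteq> s + squarefree F" for s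
      by (auto simp: poly_mapping_eq_iff fun_eq_iff lookup_add lookup_squarefree intro!: exI[of _ j])
    with False show ?thesis by (simp add: coeff_at_def)
  qed (simp add: coeff_at_def)
  have "coeff_at (koszul_diff u) a = coeff_at v a" for a
  \<comment> \<open>Degree 0 has no variable to cone over. Only the empty set occurs there, and its
    coefficient in \<open>v\<close> vanishes by \<open>const\<close> or, for \<open>i > 0\<close>,
    by \<open>supp\<close>.\<close>
  proof (cases "a = 0")
    case True
    have "coeff_at v 0 = (\<lambda>_. 0)"
      using const supp[of "{}"] by (cases "i = 0") (auto simp: coeff_0 fun_eq_iff)
    moreover have "simplex_boundary (coeff_at u 0) = (\<lambda>_. 0)"
      by (simp add: simplex_boundary_def coeff_0 fun_eq_iff)
    ultimately show ?thesis
      using True by (simp add: coeff_at_koszul_diff)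
  next
    case False
    then show ?thesis
      by (simp add: coeff_at_koszul_diff coeff_u simplex_boundary_cone[OF bd])
  qed
  then have "koszul_diff u = v"
    by (rule coeff_at_eqD)
  moreover have "u F = 0" if "card F \<noteq> Suc i" for F
  proof (rule poly_mapping_eqI)
    fix t
    have "card (F - {j}) \<noteq> i" if "j \<in> F" for j
      using \<open>card F \<noteq> Suc i\<close> that card_Suc_Diff1[of F j] by auto
    then have "g F t = 0"
      using supp by (auto simp: g_def cone_def coeff_at_def)
    then show "lookup (u F) t = lookup 0 t"
      by (simp add: u_def lookup_u)
  qed
  ultimately show thesis using that by blast
qed

section \<open>The Koszul complex as a resolution given by matrices\<close>

definition set_code :: "'n::finite set \<Rightarrow> nat" where
  "set_code = to_nat_on UNIV"

definition set_decode :: "nat \<Rightarrow> 'n::finite set" where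
  "set_decode = inv set_code"

lemma set_code_eq_iff [simp]: "set_code F = set_code G \<longleftrightarrow> F = G"
  unfolding set_code_def by (intro inj_on_eq_iff[OF inj_on_to_nat_on]) (auto intro: countable_finite)

lemma inj_set_code: "inj_on set_code A"
  by (simp add: inj_on_def)

lemma set_decode_code [simp]: "set_decode (set_code F) = F"
  unfolding set_decode_def by (rule inv_f_f) (rule inj_set_code)

text \<open>At most one \<open>j\<close> satisfies the condition, so the sum is a single entry, or 0
  when \<open>F\<close> is not \<open>G\<close> with one vertex added.\<close>

definition koszul_coef :: "'n::{finite, linorder} set \<Rightarrow> 'n set \<Rightarrow> ('n, 'k::field) mpoly" where
  "koszul_coef G F = (\<Sum>j\<in>{j. j \<notin> G \<and> F = insert j G}. single (single j 1) (ksign j G))"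

text \<open>The record indexes bases by natural numbers, so a set of variables enters through its
  code. The single basis element in homological degree 0 is the code of the empty set, and
  \<open>aug\<close> sends it to 1.\<close>

definition koszul :: "('n::{finite, linorder}, 'k::field) free_complex" where
  "koszul = \<lparr>basis = \<lambda>i. set_code ` {F :: 'n set. card F = i},
     bdeg = \<lambda>i b. mdeg (squarefree (set_decode b)),
     coef = \<lambda>i b c. koszul_coef (set_decode b) (set_decode c),
     aug = \<lambda>b. 1\<rparr>"

lemma basis_koszul: "basis (koszul :: ('n::{finite, linorder}, 'k::field) free_complex) i =
    set_code ` {F :: 'n set. card F = i}"
  by (simp add: koszul_def)

lemma bdeg_koszul: "bdeg (koszul :: ('n::{finite, linorder}, 'k::field) free_complex) i (set_code F) =
    mdeg (squarefree (F :: 'n set))"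
  by (simp add: koszul_def)

lemma chains_koszul_iff:
  fixes v :: "nat \<Rightarrow> ('n::{finite, linorder}, 'k::field) mpoly"
  shows "v \<in> chains koszul i \<longleftrightarrow> (\<forall>b. b \<notin> set_code ` {F :: 'n set. card F = i} \<longrightarrow> v b = 0)"
  by (simp add: chains_def basis_koszul)

lemma chains_koszul_zero:
  fixes v :: "nat \<Rightarrow> ('n::{finite, linorder}, 'k::field) mpoly" and F :: "'n set"
  shows "v \<in> chains koszul i \<Longrightarrow> card F \<noteq> i \<Longrightarrow> v (set_code F) = 0"
  by (auto simp: chains_koszul_iff dest!: spec[of _ "set_code F"])

lemma chains_koszul_eqI:
  fixes v w :: "nat \<Rightarrow> ('n::{finite, linorder}, 'k::field) mpoly"
  assumes "v \<in> chains koszul i" "w \<in> chains koszul i" "v \<circ> set_code = w \<circ> (set_code :: 'n set \<Rightarrow> nat)"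
  shows "v = w"
proof
  fix b
  show "v b = w b"
    using assms by (cases "b \<in> set_code ` {F :: 'n set. card F = i}") (auto simp: chains_koszul_iff fun_eq_iff)
qed

lemma chains_koszul_of_family:
  fixes w :: "'n::{finite, linorder} set \<Rightarrow> ('n, 'k::field) mpoly"
  assumes "\<And>F. card F \<noteq> i \<Longrightarrow> w F = 0"
  obtains v where "v \<in> chains koszul i" "v \<circ> set_code = w"
proof
  let ?v = "\<lambda>b. if b \<in> set_code ` {F :: 'n set. card F = i} then w (set_decode b) else 0"
  show "?v \<in> chains koszul i"
    by (simp add: chains_koszul_iff)
  show "?v \<circ> set_code = w"
    using assms by (auto simp: fun_eq_iff image_iff)
qed

lemma diff_koszul:
  fixes v :: "nat \<Rightarrow> ('n::{finite, linorder}, 'k::field) mpoly"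
  assumes "v \<in> chains koszul (Suc i)"
  shows "diff koszul i v \<circ> set_code = koszul_diff (v \<circ> set_code)"
proof
  fix G :: "'n set"
  show "(diff koszul i v \<circ> set_code) G = koszul_diff (v \<circ> set_code) G"
  proof (cases "card G = i")
    case True
    have "(diff koszul i v \<circ> set_code) G = (\<Sum>F\<in>{F. card F = Suc i}. koszul_coef G F * v (set_code F))"
      using True
      by (simp add: diff_def basis_koszul sum.reindex[OF inj_set_code]) (simp add: koszul_def)
    also have "\<dots> = (\<Sum>F\<in>{F. card F = Suc i}. \<Sum>j | j \<in> - G \<and> F = insert j G.
        single (single j 1) (ksign j G) * v (set_code F))"
      by (simp add: koszul_coef_def sum_distrib_right)
    \<comment> \<open>After the exchange \<open>j\<close> determines \<open>F = insert j G\<close>,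
      which leaves the sum over \<open>j\<close> of the Koszul differential.\<close>
    also have "\<dots> = (\<Sum>j\<in>-G. \<Sum>F | F \<in> {F. card F = Suc i} \<and> F = insert j G.
        single (single j 1) (ksign j G) * v (set_code F))"
      by (rule sum.swap_restrict) simp_all
    also have "\<dots> = koszul_diff (v \<circ> set_code) G"
      unfolding koszul_diff_def
    proof (rule sum.cong)
      fix j assume "j \<in> - G"
      then have "{F. F \<in> {F. card F = Suc i} \<and> F = insert j G} = {insert j G}"
        using True by auto
      then show "(\<Sum>F | F \<in> {F. card F = Suc i} \<and> F = insert j G. single (single j 1) (ksign j G) * v (set_code F)) =
          single (single j 1) (ksign j G) * (v \<circ> set_code) (insert j G)"
        by simp
    qed simp
    finally show ?thesis .
  next
    case False
    then have "v (set_code (insert j G)) = 0" if "j \<in> - G" for j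
      using that by (intro chains_koszul_zero[OF assms]) auto
    then have "koszul_diff (v \<circ> set_code) G = 0"
      by (simp add: koszul_diff_def)
    moreover have "set_code G \<notin> basis (koszul :: ('n, 'k) free_complex) i"
      using False by (auto simp: basis_koszul)
    ultimately show ?thesis
      by (simp add: diff_def)
  qed
qed

lemma augment_koszul:
  fixes v :: "nat \<Rightarrow> ('n::{finite, linorder}, 'k::field) mpoly"
  shows "augment koszul v = lookup (v (set_code ({} :: 'n set))) 0"
proof -
  have "{F :: 'n set. card F = 0} = {{}}" by auto
  then show ?thesis
    by (simp add: augment_def basis_koszul) (simp add: koszul_def)
qed

lemma koszul_diff_koszul_diff: "koszul_diff (koszul_diff v) = (\<lambda>_. 0)"
  by (rule coeff_at_eqD) (simp add: coeff_at_koszul_diff simplex_boundary_simplex_boundary)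

lemma koszul_diff_const:
  fixes v :: "'n::{finite, linorder} set \<Rightarrow> ('n, 'k::field) mpoly"
  shows "lookup (koszul_diff v {}) 0 = 0"
proof -
  have "single j 1 \<noteq> (0 :: 'n monom)" for j
    by (metis lookup_single_eq lookup_zero one_neq_zero)
  then show ?thesis
    by (simp add: koszul_diff_def lookup_sum lookup_mult_0 lookup_single when_def)
qed

lemma koszul_coef_component:
  "koszul_coef G F \<in> component (mdeg (squarefree F) - mdeg (squarefree G))"
  unfolding koszul_coef_def
  by (rule component_sum) (auto intro!: single_in_component simp: squarefree_insert mdeg_add)

lemma diff_koszul_eq_0_iff:
  assumes "v \<in> chains koszul (Suc i)"
  shows "diff koszul i v = (\<lambda>_. 0) \<longleftrightarrow> koszul_diff (v \<circ> set_code) = (\<lambda>_. 0)"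
proof
  assume "diff koszul i v = (\<lambda>_. 0)"
  then show "koszul_diff (v \<circ> set_code) = (\<lambda>_. 0)"
    using diff_koszul[OF assms] by (simp add: comp_def)
next
  assume "koszul_diff (v \<circ> set_code) = (\<lambda>_. 0)"
  then show "diff koszul i v = (\<lambda>_. 0)"
    using diff_koszul[OF assms]
    by (intro chains_koszul_eqI[of _ i]) (auto simp: chains_def diff_def comp_def)
qed

text \<open>Serves exactness at every place of the complex: for \<open>i = 0\<close> the first
  condition holds for all chains, and the second one is exactness at the augmentation.\<close>

lemma koszul_boundary:
  fixes v :: "nat \<Rightarrow> ('n::{finite, linorder}, 'k::field) mpoly"
  assumes v: "v \<in> chains koszul i"
  shows "v \<in> diff koszul i ` chains koszul (Suc i) \<longleftrightarrow>
    koszul_diff (v \<circ> (set_code :: 'n set \<Rightarrow> nat)) = (\<lambda>_. 0) \<and> (i = 0 \<longrightarrow> augment koszul v = 0)"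
proof
  assume "v \<in> diff koszul i ` chains koszul (Suc i)"
  then obtain u where u: "u \<in> chains koszul (Suc i)" "v = diff koszul i u" by blast
  have *: "v \<circ> set_code = koszul_diff (u \<circ> (set_code :: 'n set \<Rightarrow> nat))"
    using diff_koszul[OF u(1)] u(2) by simp
  then have "augment koszul v = 0"
    using koszul_diff_const[of "u \<circ> set_code"] by (simp add: augment_koszul fun_eq_iff)
  with * show "koszul_diff (v \<circ> (set_code :: 'n set \<Rightarrow> nat)) = (\<lambda>_. 0) \<and> (i = 0 \<longrightarrow> augment koszul v = 0)"
    by (simp add: koszul_diff_koszul_diff)
next
  assume *: "koszul_diff (v \<circ> (set_code :: 'n set \<Rightarrow> nat)) = (\<lambda>_. 0) \<and> (i = 0 \<longrightarrow> augment koszul v = 0)"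
  obtain w where w: "\<And>F. card F \<noteq> Suc i \<Longrightarrow> w F = 0" "koszul_diff w = v \<circ> (set_code :: 'n set \<Rightarrow> nat)"
    by (rule koszul_exact[of i "v \<circ> (set_code :: 'n set \<Rightarrow> nat)"])
       (use * v in \<open>auto simp: chains_koszul_zero augment_koszul\<close>)
  obtain u where u: "u \<in> chains koszul (Suc i)" "u \<circ> set_code = w"
    using chains_koszul_of_family[of "Suc i" w, OF w(1)] by blast
  have "diff koszul i u = v"
    using diff_koszul[OF u(1)] u(2) w(2) v
    by (intro chains_koszul_eqI[of _ i]) (auto simp: chains_def diff_def)
  with u(1) show "v \<in> diff koszul i ` chains koszul (Suc i)" by blast
qed

lemma diff_koszul_in_chains: "diff koszul i ` A \<subseteq> chains koszul i"
  by (auto simp: chains_def diff_def)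

lemma koszul_resolution: "graded_free_resolution (koszul :: ('n::{finite, linorder}, 'k::field) free_complex)"
proof -
  let ?K = "koszul :: ('n, 'k) free_complex"
  have aug: "augment ?K ` chains ?K 0 = UNIV"
  proof -
    have "x \<in> augment ?K ` chains ?K 0" for x
    proof
      let ?v = "\<lambda>b. if b = set_code ({} :: 'n set) then single 0 x else 0"
      show "x = augment ?K ?v" by (simp add: augment_koszul)
      show "?v \<in> chains ?K 0" by (auto simp: chains_koszul_iff)
    qed
    then show ?thesis by blast
  qed
  have 0: "koszul_diff (v \<circ> set_code) = (\<lambda>_. 0)" if "v \<in> chains ?K 0" for v
    unfolding koszul_diff_def using chains_koszul_zero[OF that] by (simp add: fun_eq_iff)
  have "{v \<in> chains ?K 0. augment ?K v = 0} = diff ?K 0 ` chains ?K 1"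
    using diff_koszul_in_chains[of 0 "chains ?K 1"] koszul_boundary[of _ 0] 0 by auto
  moreover have "{v \<in> chains ?K (Suc i). diff ?K i v = (\<lambda>_. 0)} = diff ?K (Suc i) ` chains ?K (Suc (Suc i))" for i
    using diff_koszul_in_chains[of "Suc i" "chains ?K (Suc (Suc i))"] koszul_boundary[of _ "Suc i"]
      diff_koszul_eq_0_iff[of _ i] by auto
  moreover have "coef ?K i b c \<in> component (bdeg ?K (Suc i) c - bdeg ?K i b)" for i b c
    by (simp add: koszul_def koszul_coef_component)
  moreover have "\<forall>b\<in>basis ?K 0. bdeg ?K 0 b = 0"
    by (auto simp: basis_koszul bdeg_koszul)
  ultimately show ?thesis
    using aug by (simp add: graded_free_resolution_def basis_koszul)
qed

section \<open>Tor of a stable ideal\<close>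

text \<open>A face is a set \<open>F\<close> such that \<open>x\<^sup>a / x\<^sub>F\<close> is a monomial in the ideal generated by \<open>M\<close>.\<close>

definition upper_koszul :: "'n::finite monom set \<Rightarrow> 'n monom \<Rightarrow> 'n set set" where
  "upper_koszul M a = {F. \<exists>w\<in>M. \<exists>s. a = w + s + squarefree F}"

text \<open>A homogeneous polynomial of given multidegree is a scalar times one monomial, so a chain
  of degree \<open>a\<close> amounts to one scalar for each \<open>F\<close>, which can be nonzero
  only if \<open>x^a / x_F\<close> lies in the ideal.\<close>

lemma tensor_component_koszulD:
  fixes v :: "nat \<Rightarrow> ('n::{finite, linorder}, 'k::field) mpoly"
  assumes v: "v \<in> tensor_component koszul i (ideal.span (monomial ` M)) (mdeg a)"
  shows "coeff_at (v \<circ> set_code) a F \<noteq> 0 \<Longrightarrow> F \<in> upper_koszul M a \<and> card F = i"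
    and "a' \<noteq> a \<Longrightarrow> coeff_at (v \<circ> set_code) a' = (\<lambda>_. 0)"
proof -
  have key: "t + squarefree F = a \<and> (\<exists>w\<in>M. \<exists>s. t = w + s) \<and> card F = i"
    if "t \<in> keys (v (set_code F))" for t and F :: "'n set"
  proof -
    have F: "card F = i"
      using that v chains_koszul_zero[of v i F] by (cases "card F = i") (auto simp: tensor_component_def)
    then have "v (set_code F) \<in> ideal.span (monomial ` M)"
      and "v (set_code F) \<in> component (mdeg a - mdeg (squarefree F))"
      using v by (auto simp: tensor_component_def basis_koszul bdeg_koszul)
    then have "mdeg t = mdeg a - mdeg (squarefree F)" "\<exists>w\<in>M. \<exists>s. t = w + s"
      using that by (auto simp: monomial_ideal_iff component_def)
    moreover from this(1) have "mdeg (t + squarefree F) = mdeg a"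
      by (simp add: mdeg_add)
    ultimately show ?thesis
      using F by simp
  qed
  have coeff: "\<exists>t. t \<in> keys (v (set_code F)) \<and> a' = t + squarefree F"
    if "coeff_at (v \<circ> set_code) a' F \<noteq> 0" for a' and F :: "'n set"
    using that by (auto simp: coeff_at_def in_keys_iff split: if_splits)
  show "coeff_at (v \<circ> set_code) a F \<noteq> 0 \<Longrightarrow> F \<in> upper_koszul M a \<and> card F = i"
    using coeff[of a F] key[of _ F] unfolding upper_koszul_def by blast
  show "a' \<noteq> a \<Longrightarrow> coeff_at (v \<circ> set_code) a' = (\<lambda>_. 0)"
    using coeff[of a'] key by (auto simp: fun_eq_iff)
qed

text \<open>The scalars can be prescribed freely on the faces with \<open>i\<close> elements,
  because there \<open>x^a / x_F\<close> lies in the ideal and can serve as the entry.\<close>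

lemma tensor_component_koszulE:
  fixes c :: "'n::{finite, linorder} set \<Rightarrow> 'k::field"
  assumes c: "\<And>F. c F \<noteq> 0 \<Longrightarrow> F \<in> upper_koszul M a \<and> card F = i"
  obtains v where "v \<in> tensor_component koszul i (ideal.span (monomial ` M)) (mdeg a)"
    "coeff_at (v \<circ> set_code) a = c"
proof -
  define w where "w F = single (a - squarefree F) (c F)" for F
  have "w F = 0" if "card F \<noteq> i" for F
    using c[of F] that by (cases "c F = 0") (auto simp: w_def)
  then obtain v where v: "v \<in> chains koszul i" "v \<circ> set_code = w"
    by (rule chains_koszul_of_family)
  have "v (set_code F) \<in> ideal.span (monomial ` M) \<inter> component (mdeg a - mdeg (squarefree F))"
    for F :: "'n set"
  proof -
    have vF: "v (set_code F) = w F"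
      using v(2) by (simp add: fun_eq_iff)
    show ?thesis
    proof (cases "c F = 0")
      case False
      then obtain x s where x: "x \<in> M" "a = x + s + squarefree F"
        using c[of F] by (auto simp: upper_koszul_def)
      then have "w F \<in> ideal.span (monomial ` M)"
        by (auto simp: w_def monomial_ideal_iff)
      moreover have "w F \<in> component (mdeg a - mdeg (squarefree F))"
        unfolding w_def by (rule single_in_component) (simp add: x mdeg_add)
      ultimately show ?thesis by (simp add: vF)
    qed (simp add: vF w_def ideal.span_zero)
  qed
  then have "v \<in> tensor_component koszul i (ideal.span (monomial ` M)) (mdeg a)"
    using v(1) by (auto simp: tensor_component_def basis_koszul bdeg_koszul)
  moreover have "coeff_at (v \<circ> set_code) a = c"
  proof
    fix F show "coeff_at (v \<circ> set_code) a F = c F"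
      using c[of F] by (auto simp: v(2) w_def coeff_at_def upper_koszul_def)
  qed
  ultimately show thesis by (rule that)
qed

text \<open>A face with \<open>i\<close> elements has dimension \<open>i - 1\<close>, so the
  right-hand side is reduced homology in dimension \<open>i - 1\<close>. A chain of degree
  \<open>a\<close> is zero in all other multidegrees, so identities are tested at \<open>a\<close>
  alone.\<close>

lemma Tor_nonzero_monomial_ideal_iff:
  fixes M :: "'n::{finite, linorder} monom set"
  shows "Tor_nonzero i (ideal.span (monomial ` M) :: ('n, 'k::field) mpoly set) (mdeg a) \<longleftrightarrow>
    (\<exists>c :: 'n set \<Rightarrow> 'k. (\<forall>F. c F \<noteq> 0 \<longrightarrow> F \<in> upper_koszul M a \<and> card F = i) \<and>
       simplex_boundary c = (\<lambda>_. 0) \<and>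
       \<not> (\<exists>e. (\<forall>F. e F \<noteq> 0 \<longrightarrow> F \<in> upper_koszul M a \<and> card F = Suc i) \<and> simplex_boundary e = c))"
    (is "_ \<longleftrightarrow> (\<exists>c. ?supp i c \<and> ?closed c \<and> \<not> ?exact c)")
proof -
  let ?J = "ideal.span (monomial ` M) :: ('n, 'k) mpoly set"
  let ?T = "\<lambda>i. tensor_component koszul i ?J (mdeg a)"
  let ?Z = "tensor_cycles koszul i ?J (mdeg a)" and ?B = "tensor_boundaries koszul i ?J (mdeg a)"
  let ?c = "\<lambda>v. coeff_at (v \<circ> set_code) a :: 'n set \<Rightarrow> 'k"
  have chain: "v \<in> chains koszul i" if "v \<in> ?T i" for v i
    using that by (simp add: tensor_component_def)
  have supp: "?supp i (?c v)" if "v \<in> ?T i" for v i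
    using tensor_component_koszulD(1)[OF that] by blast
  have eqI: "v \<circ> set_code = w \<circ> (set_code :: 'n set \<Rightarrow> nat)" if "?c v = ?c w"
    "\<And>a'. a' \<noteq> a \<Longrightarrow> coeff_at (v \<circ> set_code) a' = coeff_at (w \<circ> (set_code :: 'n set \<Rightarrow> nat)) a'" for v w
    by (rule coeff_at_eqD) (use that in metis)
  have other: "coeff_at (v \<circ> (set_code :: 'n set \<Rightarrow> nat)) a' = (\<lambda>_. 0)" if "v \<in> ?T i" "a' \<noteq> a" for v i a'
    using tensor_component_koszulD(2)[OF that] .
  have diff_c: "?c (diff koszul i v) = simplex_boundary (?c v)" if "v \<in> ?T (Suc i)" for v i
    by (simp add: diff_koszul[OF chain[OF that]] coeff_at_koszul_diff)
  have diff_other: "coeff_at (diff koszul i v \<circ> (set_code :: 'n set \<Rightarrow> nat)) a' = (\<lambda>_. 0)"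
    if "v \<in> ?T (Suc i)" "a' \<noteq> a" for v i a'
    by (simp add: diff_koszul[OF chain[OF that(1)]] coeff_at_koszul_diff other[OF that])
  have cycle: "v \<in> ?Z \<longleftrightarrow> ?closed (?c v)" if v: "v \<in> ?T i" for v
  proof (cases i)
    case 0
    \<comment> \<open>Every chain counts as a cycle when \<open>i = 0\<close>; its scalars are then
      closed as well, as they live on the empty set.\<close>
    have "?c v (insert j G) = 0" for j G
      using supp[OF v] 0 by (metis card_eq_0_iff finite insert_not_empty)
    then have "?closed (?c v)"
      unfolding simplex_boundary_def by (simp only: mult_zero_right sum.neutral_const)
    with v 0 show ?thesis by simp
  next
    case (Suc j)
    then have v': "v \<in> ?T (Suc j)" using v by simp
    have "diff koszul j v = (\<lambda>_. 0) \<longleftrightarrow> koszul_diff (v \<circ> set_code) = (\<lambda>_. 0)"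
      by (rule diff_koszul_eq_0_iff[OF chain[OF v']])
    also have "\<dots> \<longleftrightarrow> ?closed (?c v)"
    proof
      assume "?closed (?c v)"
      then have "coeff_at (koszul_diff (v \<circ> set_code)) a' = coeff_at (\<lambda>_. 0) a'" for a'
        using other[OF v'] by (cases "a' = a") (simp_all add: coeff_at_koszul_diff)
      then show "koszul_diff (v \<circ> set_code) = (\<lambda>_. 0)" by (rule coeff_at_eqD)
    qed (metis coeff_at_koszul_diff coeff_at_0)
    finally show ?thesis
      using v' Suc by simp
  qed
  have boundary: "v \<in> ?B \<longleftrightarrow> ?exact (?c v)" if v: "v \<in> ?T i" for v
  proof
    assume "v \<in> ?B"
    then obtain u where u: "u \<in> ?T (Suc i)" "v = diff koszul i u"
      by (auto simp: tensor_boundaries_def)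
    then show "?exact (?c v)"
      using supp[OF u(1)] diff_c[OF u(1)] by metis
  next
    assume "?exact (?c v)"
    then obtain e where e: "?supp (Suc i) e" "simplex_boundary e = ?c v" by blast
    then obtain u where u: "u \<in> ?T (Suc i)" "?c u = e"
      using tensor_component_koszulE[of e M a "Suc i"] by blast
    have "diff koszul i u \<circ> (set_code :: 'n set \<Rightarrow> nat) = v \<circ> set_code"
      using e(2) u(2) diff_c[OF u(1)] diff_other[OF u(1)] other[OF v] by (intro eqI) simp_all
    then have "diff koszul i u = v"
      using chain[OF v] by (intro chains_koszul_eqI[of _ i]) (auto simp: chains_def diff_def)
    with u(1) show "v \<in> ?B"
      by (auto simp: tensor_boundaries_def)
  qed
  have "\<not> ?Z \<subseteq> ?B \<longleftrightarrow> (\<exists>c. ?supp i c \<and> ?closed c \<and> \<not> ?exact c)"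
  proof
    assume "\<not> ?Z \<subseteq> ?B"
    then obtain v where v: "v \<in> ?Z" "v \<notin> ?B" by blast
    moreover from v(1) have "v \<in> ?T i"
      using tensor_cycles_subset_component by blast
    ultimately show "\<exists>c. ?supp i c \<and> ?closed c \<and> \<not> ?exact c"
      using supp cycle boundary by blast
  next
    assume "\<exists>c. ?supp i c \<and> ?closed c \<and> \<not> ?exact c"
    then obtain c where c: "?supp i c" "?closed c" "\<not> ?exact c" by blast
    then obtain v where "v \<in> ?T i" "?c v = c"
      using tensor_component_koszulE[of c M a i] by blast
    then have "v \<in> ?Z" "v \<notin> ?B"
      using c cycle boundary by simp_all
    then show "\<not> ?Z \<subseteq> ?B" by blast
  qed
  then show ?thesis
    by (subst Tor_nonzero_iff[OF koszul_resolution ideal.subspace_span]) blast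
qed

text \<open>The exchange \<open>x_j w / x_m\<close>, stated without division. It is required for
  every variable of \<open>w\<close>, not just the largest, which is strong stability, and for the
  given generators rather than for all monomials of the ideal.\<close>

definition stable :: "'n::linorder monom set \<Rightarrow> bool" where
  "stable M \<longleftrightarrow> (\<forall>w\<in>M. \<forall>m\<in>keys w. \<forall>j<m. \<exists>w'\<in>M. w' + single m 1 = w + single j 1)"

lemma stableE:
  assumes "stable M" "w \<in> M" "m \<in> keys w" "j < m"
  obtains w' where "w' \<in> M" "w' + single m 1 = w + single j 1"
  using assms unfolding stable_def by blast

definition total_degree :: "'n::finite monom \<Rightarrow> nat" where
  "total_degree t = (\<Sum>j\<in>UNIV. lookup t j)"

lemma total_degree_add: "total_degree (s + t) = total_degree s + total_degree t"
  by (simp add: total_degree_def lookup_add sum.distrib)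

lemma total_degree_squarefree: "total_degree (squarefree F) = card F"
  by (simp add: total_degree_def lookup_squarefree flip: sum.inter_restrict)

text \<open>The multidegrees of the Eliahou-Kervaire resolution in homological degree \<open>i\<close>.\<close>

definition eliahou_kervaire :: "'n::{finite, linorder} monom set \<Rightarrow> nat \<Rightarrow> 'n monom set" where
  "eliahou_kervaire M i =
    {w + squarefree G | w G. w \<in> M \<and> card G = i \<and> (\<forall>g\<in>G. \<exists>m\<in>keys w. g < m)}"

text \<open>Unless \<open>a\<close> is an Eliahou-Kervaire degree, stability makes the cone over the largest variable
  of \<open>a\<close> preserve the upper Koszul complex in dimension \<open>i\<close>.\<close>

lemma upper_koszul_cone:
  assumes M: "stable M" and F: "F \<in> upper_koszul M a" "m \<notin> F"
    and m: "m \<in> keys a" "\<forall>j\<in>keys a. j \<le> m" and a: "a \<notin> eliahou_kervaire M (card F)"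
  shows "insert m F \<in> upper_koszul M a"
proof -
  obtain w s where w: "w \<in> M" and a_eq: "a = w + s + squarefree F"
    using F(1) by (auto simp: upper_koszul_def)
  have keys_a: "j \<in> keys a \<longleftrightarrow> j \<in> keys w \<or> j \<in> keys s \<or> j \<in> F" for j
    unfolding a_eq by (auto simp: in_keys_iff lookup_add lookup_squarefree)
  \<comment> \<open>It suffices to split \<open>x_m\<close> off the cofactor, possibly after
    changing the generator.\<close>
  have goal: ?thesis if "w' \<in> M" "w + s = w' + s' + single m 1" for w' s'
    using that F(2) unfolding upper_koszul_def a_eq
    by (auto intro!: bexI[of _ w'] exI[of _ s'] simp: squarefree_insert ac_simps)
  show ?thesis
  proof (cases "m \<in> keys s")
    case True
    then obtain s' where "s = s' + single m 1" by (rule split_variable)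
    then show ?thesis using w by (intro goal[of w s']) (auto simp: ac_simps)
  next
    case False
    then have mw: "m \<in> keys w" using m(1) F(2) by (simp add: keys_a)
    \<comment> \<open>With a trivial cofactor, \<open>m\<close> would be a variable of
      \<open>w\<close> above all of \<open>F\<close>, so \<open>a\<close> would be an
      Eliahou-Kervaire degree.\<close>
    have "s \<noteq> 0"
    proof
      assume "s = 0"
      have "\<forall>g\<in>F. \<exists>m\<in>keys w. g < m"
        using mw m(2) F(2) keys_a by (metis order_le_imp_less_or_eq)
      with w \<open>s = 0\<close> a a_eq show False
        unfolding eliahou_kervaire_def by fastforce
    qed
    then obtain j where j: "j \<in> keys s" by (auto simp flip: keys_eq_empty)
    then have "j < m" using m(2) False keys_a by (metis order_le_imp_less_or_eq)
    \<comment> \<open>The exchange moves \<open>x_m\<close> from the generator to the cofactor in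
      return for \<open>x_j\<close>.\<close>
    then obtain w' where w': "w' \<in> M" "w' + single m 1 = w + single j 1"
      using stableE[OF M w mw] by blast
    obtain s' where s': "s = s' + single j 1" using j by (rule split_variable)
    have "w + s = (w + single j 1) + s'"
      by (simp add: s' ac_simps)
    also have "\<dots> = w' + s' + single m 1"
      unfolding w'(2)[symmetric] by (simp only: ac_simps)
    finally show ?thesis using w'(1) by (intro goal)
  qed
qed

lemma Tor_nonzero_stable_iff:
  fixes M :: "'n::{finite, linorder} monom set"
  assumes M: "stable M" and deg: "\<And>w. w \<in> M \<Longrightarrow> total_degree w = D"
  shows "Tor_nonzero i (ideal.span (monomial ` M) :: ('n, 'k::field) mpoly set) (mdeg a) \<longleftrightarrow>
    a \<in> eliahou_kervaire M i"
proof
  assume "Tor_nonzero i (ideal.span (monomial ` M) :: ('n, 'k) mpoly set) (mdeg a)"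
  then obtain c :: "'n set \<Rightarrow> 'k" where
      supp: "\<And>F. c F \<noteq> 0 \<Longrightarrow> F \<in> upper_koszul M a \<and> card F = i"
      and closed: "simplex_boundary c = (\<lambda>_. 0)"
      and not_exact: "\<And>e. (\<And>F. e F \<noteq> 0 \<Longrightarrow> F \<in> upper_koszul M a \<and> card F = Suc i) \<Longrightarrow> simplex_boundary e \<noteq> c"
    unfolding Tor_nonzero_monomial_ideal_iff by blast
  show "a \<in> eliahou_kervaire M i"
  proof (rule ccontr)
    assume a: "a \<notin> eliahou_kervaire M i"
    have "c \<noteq> (\<lambda>_. 0)"
      using not_exact[of "\<lambda>_. 0"] by auto
    then obtain F where "c F \<noteq> 0" by auto
    then obtain w s where F: "w \<in> M" "a = w + s + squarefree F" "card F = i"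
      using supp[of F] by (auto simp: upper_koszul_def)
    \<comment> \<open>A largest variable is needed. The degree \<open>a = 0\<close> would leave only
      the empty face and the generator 1, hence \<open>i = 0\<close>, and would then be an
      Eliahou-Kervaire degree itself.\<close>
    have "a \<noteq> 0"
    proof
      assume "a = 0"
      then have "w = 0" "squarefree F = 0"
        using F(2) by (metis poly_mapping_nat_add_eq_0_iff)+
      then have "F = {}"
        using total_degree_squarefree[of F] by (simp add: total_degree_def)
      with F \<open>w = 0\<close> \<open>a = 0\<close> a show False
        by (auto simp: eliahou_kervaire_def)
    qed
    then have ne: "keys a \<noteq> {}" by simp
    define m where "m = Max (keys a)"
    have m: "m \<in> keys a" "\<forall>j\<in>keys a. j \<le> m"
      using ne by (auto simp: m_def)
    have "F \<in> upper_koszul M a \<and> card F = Suc i" if "cone m c F \<noteq> 0" for F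
    proof -
      have F: "m \<in> F" "c (F - {m}) \<noteq> 0"
        using that by (auto simp: cone_def split: if_splits)
      then have "F - {m} \<in> upper_koszul M a" "card (F - {m}) = i"
        using supp by auto
      then have "insert m (F - {m}) \<in> upper_koszul M a"
        using a m by (intro upper_koszul_cone[OF M]) auto
      then show ?thesis
        using F(1) \<open>card (F - {m}) = i\<close> card_Suc_Diff1[of F m] by (simp add: insert_absorb)
    qed
    with not_exact show False
      using simplex_boundary_cone[OF closed] by blast
  qed
next
  assume "a \<in> eliahou_kervaire M i"
  then obtain w G where w: "w \<in> M" "a = w + squarefree G" "card G = i"
      and G: "\<forall>g\<in>G. \<exists>m\<in>keys w. g < m"
    by (auto simp: eliahou_kervaire_def)
  have no_face: "card F \<noteq> Suc i" if F: "F \<in> upper_koszul M a" for F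
  proof
    assume "card F = Suc i"
    moreover obtain w' s where "w' \<in> M" "a = w' + s + squarefree F"
      using F by (auto simp: upper_koszul_def)
    then have "total_degree w' + total_degree s + card F = total_degree w + card G"
      using w(2) by (metis total_degree_add total_degree_squarefree)
    ultimately show False
      using deg \<open>w' \<in> M\<close> w by simp
  qed
  have "\<exists>c :: 'n set \<Rightarrow> 'k. (\<forall>F. c F \<noteq> 0 \<longrightarrow> F \<in> upper_koszul M a \<and> card F = i) \<and>
      simplex_boundary c = (\<lambda>_. 0) \<and> c \<noteq> (\<lambda>_. 0)"
  \<comment> \<open>For \<open>G\<close> empty the generator may be 1, with no variable to adjoin;
    the empty face itself then gives the cycle.\<close>
  proof (cases "G = {}")
    case True
    let ?c = "\<lambda>F. if F = {} then 1 else 0 :: 'k"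
    have "{} \<in> upper_koszul M a"
      using w True by (auto simp: upper_koszul_def intro!: bexI[of _ w] exI[of _ 0])
    moreover have "simplex_boundary ?c = (\<lambda>_. 0)"
      by (simp add: simplex_boundary_def fun_eq_iff)
    moreover have "?c \<noteq> (\<lambda>_. 0)"
      by (auto simp: fun_eq_iff)
    ultimately show ?thesis
      using w(3) True by (intro exI[of _ ?c]) auto
  next
    case False
    \<comment> \<open>Any variable of \<open>w\<close> above \<open>G\<close> will do, because
      stability allows exchanges of every variable of \<open>w\<close>.\<close>
    then obtain m where m: "m \<in> keys w" "Max G < m"
      using G by (meson Max_in finite)
    then have Gm: "\<forall>g\<in>G. g < m" by (meson Max_ge finite order_le_less_trans)
    then have "m \<notin> G" by blast
    obtain w0 where w0: "w = w0 + single m 1" using m(1) by (rule split_variable)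
    \<comment> \<open>By \<open>no_face\<close> the simplex on \<open>insert m G\<close> is missing
      from the complex, so its boundary, if present, bounds nothing there.\<close>
    define c :: "'n set \<Rightarrow> 'k" where "c = simplex_boundary (\<lambda>F. if F = insert m G then 1 else 0)"
    have "F \<in> upper_koszul M a \<and> card F = i" if "c F \<noteq> 0" for F
    proof -
      obtain j where j: "j \<notin> F" "insert j F = insert m G"
      proof -
        have "\<exists>j\<in>-F. ksign j F * (if insert j F = insert m G then 1 else 0 :: 'k) \<noteq> 0"
          using \<open>c F \<noteq> 0\<close> unfolding c_def simplex_boundary_def by (meson sum.neutral)
        then show thesis
          using that by (auto split: if_splits)
      qed
      have card: "card F = i"
        using j \<open>m \<notin> G\<close> w(3) by (metis card_insert_disjoint finite nat.inject)
      show ?thesis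
      \<comment> \<open>Omitting \<open>m\<close> leaves \<open>G\<close>, a face because of
        \<open>w\<close>. Omitting \<open>j \<in> G\<close> leaves a face because of
        \<open>w x_j / x_m\<close>, which stability puts among the generators.\<close>
      proof (cases "j = m")
        case True
        then have "F = G" using j \<open>m \<notin> G\<close> by (metis insert_ident)
        then show ?thesis
          using w by (auto simp: upper_koszul_def intro!: bexI[of _ w] exI[of _ 0])
      next
        case False
        then have "j \<in> G" "m \<in> F" using j by auto
        then obtain w' where w': "w' \<in> M" "w' + single m 1 = w + single j 1"
          using stableE[OF M w(1) m(1)] Gm by blast
        have G_eq: "G = insert j (F - {m})" and F_eq: "F = insert m (F - {m})"
          using j \<open>m \<notin> G\<close> \<open>j \<in> G\<close> \<open>m \<in> F\<close> by auto
        have "squarefree G = single j 1 + squarefree (F - {m})"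
          by (subst G_eq, rule squarefree_insert) (use j in auto)
        then have "a = (w + single j 1) + squarefree (F - {m})"
          by (simp add: w(2) ac_simps)
        also have "\<dots> = w' + (single m 1 + squarefree (F - {m}))"
          unfolding w'(2)[symmetric] by (rule add.assoc)
        also have "single m 1 + squarefree (F - {m}) = squarefree F"
          using squarefree_insert[of m "F - {m}"] F_eq by simp
        finally show ?thesis
          using w'(1) card by (auto simp: upper_koszul_def intro!: bexI[of _ w'] exI[of _ 0])
      qed
    qed
    moreover have "c G \<noteq> 0"
    proof -
      have "c G = (\<Sum>j\<in>-G. if j = m then ksign m G else 0)"
        unfolding c_def simplex_boundary_def
        by (rule sum.cong) (use \<open>m \<notin> G\<close> in \<open>auto simp: insert_ident\<close>)
      then show ?thesis using \<open>m \<notin> G\<close> by (simp add: ksign_nonzero)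
    qed
    moreover have "simplex_boundary c = (\<lambda>_. 0)"
      by (simp add: c_def simplex_boundary_simplex_boundary)
    ultimately show ?thesis by (intro exI[of _ c]) auto
  qed
  then obtain c :: "'n set \<Rightarrow> 'k" where c: "\<forall>F. c F \<noteq> 0 \<longrightarrow> F \<in> upper_koszul M a \<and> card F = i"
      "simplex_boundary c = (\<lambda>_. 0)" "c \<noteq> (\<lambda>_. 0)"
    by blast
  have "simplex_boundary e \<noteq> c" if "\<forall>F. e F \<noteq> 0 \<longrightarrow> F \<in> upper_koszul M a \<and> card F = Suc i" for e
  proof -
    have "e = (\<lambda>_. 0)" using that no_face by (auto simp: fun_eq_iff)
    with c(3) show ?thesis by auto
  qed
  with c(1,2) show "Tor_nonzero i (ideal.span (monomial ` M) :: ('n, 'k) mpoly set) (mdeg a)"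
    unfolding Tor_nonzero_monomial_ideal_iff by blast
qed

corollary HS_stable:
  fixes M :: "'n::{finite, linorder} monom set"
  assumes "stable M" "\<And>w. w \<in> M \<Longrightarrow> total_degree w = D"
  shows "HS i (ideal.span (monomial ` M) :: ('n, 'k::field) mpoly set) =
    ideal.span (monomial ` eliahou_kervaire M i)"
proof -
  have "{monomial a :: ('n, 'k) mpoly | a. Tor_nonzero i (ideal.span (monomial ` M) :: ('n, 'k) mpoly set) (mdeg a)} =
      monomial ` eliahou_kervaire M i"
    using Tor_nonzero_stable_iff[OF assms, where 'k = 'k] by blast
  then show ?thesis
    unfolding HS_def by simp
qed

section \<open>Principal Borel ideals\<close>

definition borel_monomials :: "'n::{finite, linorder} monom \<Rightarrow> 'n monom set" where
  "borel_monomials u = {monom_of_list ps | ps js.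
     sorted js \<and> monom_of_list js = u \<and> sorted ps \<and> list_all2 (\<le>) ps js}"

lemma principal_borel_eq: "principal_borel u = ideal.span (monomial ` borel_monomials u)"
proof -
  have "{monomial (monom_of_list ps) :: ('a, 'b) mpoly | ps js. sorted js \<and> monom_of_list js = u \<and>
      sorted ps \<and> list_all2 (\<le>) ps js} = monomial ` borel_monomials u"
    unfolding borel_monomials_def by blast
  then show ?thesis
    unfolding principal_borel_def by simp
qed

lemma monom_of_list_Cons: "monom_of_list (j # js) = single j 1 + monom_of_list js"
  by (simp add: monom_of_list_def)

lemma lookup_monom_of_list: "lookup (monom_of_list js) j = count_list js j"
  by (induction js) (auto simp: monom_of_list_def lookup_add lookup_single when_def)

lemma monom_of_list_sort: "monom_of_list (sort js) = monom_of_list js"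
  by (rule poly_mapping_eqI) (simp add: lookup_monom_of_list flip: count_mset)

lemma keys_monom_of_list: "keys (monom_of_list js) = set js"
  by (auto simp: in_keys_iff lookup_monom_of_list count_list_0_iff)

lemma total_degree_monom_of_list:
  fixes js :: "'n::finite list"
  shows "total_degree (monom_of_list js) = length js"
proof (induction js)
  case Nil
  show ?case by (simp add: monom_of_list_def total_degree_def)
next
  case (Cons j js)
  have "total_degree (single j 1) = 1"
    by (simp add: total_degree_def lookup_single when_def)
  with Cons show ?case by (simp add: monom_of_list_Cons total_degree_add)
qed

lemma monom_of_list_update:
  "i < length js \<Longrightarrow> monom_of_list (js[i := x]) + single (js ! i) 1 = monom_of_list js + single x 1"
proof (induction js arbitrary: i)
  case (Cons j js)
  then show ?case
    by (cases i) (simp_all add: monom_of_list_Cons ac_simps)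
qed simp

text \<open>If \<open>x\<close> stops at the head and \<open>y\<close> does not, then
  \<open>a \<le> b < y\<close>, and the induction hypothesis is applied to inserting
  \<open>a\<close> into its own tail. In the opposite case \<open>b\<close> is inserted into its own
  tail, using \<open>x \<le> y \<le> b\<close>.\<close>

lemma list_all2_insort:
  fixes x y :: "'a::linorder"
  assumes "list_all2 (\<le>) xs ys" "x \<le> y" "sorted xs" "sorted ys"
  shows "list_all2 (\<le>) (insort x xs) (insort y ys)"
  using assms
proof (induction arbitrary: x y rule: list_all2_induct)
  case (Cons a as b bs)
  show ?case
  proof (cases "x \<le> a")
    case True
    show ?thesis
    proof (cases "y \<le> b")
      case True
      with \<open>x \<le> a\<close> Cons show ?thesis by simp
    next
      case False
      have "list_all2 (\<le>) (insort a as) (insort y bs)"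
        using Cons False by (intro Cons.IH) auto
      moreover have "insort a as = a # as"
        using Cons.prems by (cases as) auto
      ultimately show ?thesis
        using True False Cons by auto
    qed
  next
    case False
    show ?thesis
    proof (cases "y \<le> b")
      case True
      have "list_all2 (\<le>) (insort x as) (insort b bs)"
        using Cons True by (intro Cons.IH) auto
      moreover have "insort b bs = b # bs"
        using Cons.prems by (cases bs) auto
      ultimately show ?thesis
        using True False Cons by auto
    next
      case False
      with \<open>\<not> x \<le> a\<close> Cons show ?thesis by auto
    qed
  qed
qed simp

lemma list_all2_sort:
  fixes xs ys :: "'a::linorder list"
  shows "list_all2 (\<le>) xs ys \<Longrightarrow> list_all2 (\<le>) (sort xs) (sort ys)"
  by (induction rule: list_all2_induct) (auto intro: list_all2_insort)

text \<open>Sorting preserves domination by a sorted list, so \<open>ps\<close> may come in any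
  order. Lowering one entry can destroy the order, which is why the exchange property relies on this
  form.\<close>

lemma borel_monomialsI:
  assumes "sorted js" "monom_of_list js = u" "list_all2 (\<le>) ps js"
  shows "monom_of_list ps \<in> borel_monomials u"
proof -
  have "list_all2 (\<le>) (sort ps) js"
    using list_all2_sort[OF assms(3)] assms(1) by (simp add: sorted_sort_id)
  then show ?thesis
    unfolding borel_monomials_def using assms(1,2) sorted_sort[of ps] monom_of_list_sort[of ps, symmetric]
    by blast
qed

lemma stable_borel_monomials: "stable (borel_monomials u)"
  unfolding stable_def
proof (intro ballI allI impI)
  fix w m j
  assume "w \<in> borel_monomials u" and m: "m \<in> keys w" and "j < m"
  then obtain ps js where w: "w = monom_of_list ps" "sorted js" "monom_of_list js = u" "list_all2 (\<le>) ps js"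
    by (auto simp: borel_monomials_def)
  then obtain i where i: "i < length ps" "ps ! i = m"
    using m by (auto simp: keys_monom_of_list in_set_conv_nth)
  have "j \<le> js ! i"
    using list_all2_nthD[OF w(4) i(1)] i(2) \<open>j < m\<close> by simp
  then have "list_all2 (\<le>) (ps[i := j]) js"
    using w(4) i(1) by (auto simp: list_all2_conv_all_nth nth_list_update)
  then have "monom_of_list (ps[i := j]) \<in> borel_monomials u"
    using w(2,3) by (intro borel_monomialsI)
  moreover have "monom_of_list (ps[i := j]) + single m 1 = w + single j 1"
    using monom_of_list_update[OF i(1), of j] i(2) w(1) by simp
  ultimately show "\<exists>w'\<in>borel_monomials u. w' + single m 1 = w + single j 1" by blast
qed

lemma total_degree_borel_monomials:
  "w \<in> borel_monomials u \<Longrightarrow> total_degree w = total_degree u"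
  by (auto simp: borel_monomials_def total_degree_monom_of_list dest: list_all2_lengthD)

section \<open>Generators of the powers\<close>

primrec power_monomials :: "'n monom set \<Rightarrow> nat \<Rightarrow> 'n monom set" where
  "power_monomials B 0 = {0}"
| "power_monomials B (Suc k) = {b + w | b w. b \<in> B \<and> w \<in> power_monomials B k}"

lemma ideal_power_monomial:
  "ideal_power (ideal.span (monomial ` B)) k =
    (ideal.span (monomial ` power_monomials B k) :: ('n, 'k::field) mpoly set)"
proof (induction k)
  case 0
  have "f \<in> ideal.span (monomial ` {0})" for f :: "('n, 'k) mpoly"
    unfolding monomial_ideal_iff by simp
  then show ?case by auto
qed (simp add: ideal_mult_monomial)

text \<open>A variable dividing a product divides one of the two factors, and the exchange is made
  there.\<close>

lemma stable_sum:
  assumes "stable A" "stable B"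
  shows "stable {a + b | a b. a \<in> A \<and> b \<in> B}"
  unfolding stable_def
proof clarify
  fix a b m j
  assume ab: "a \<in> A" "b \<in> B" and m: "m \<in> keys (a + b)" and "j < m"
  have "m \<in> keys a \<or> m \<in> keys b"
    using m keys_add[of a b] by blast
  then show "\<exists>w\<in>{a + b | a b. a \<in> A \<and> b \<in> B}. w + single m 1 = a + b + single j 1"
  proof
    assume "m \<in> keys a"
    then obtain a' where "a' \<in> A" "a' + single m 1 = a + single j 1"
      using stableE[OF assms(1) ab(1)] \<open>j < m\<close> by blast
    then have "a' + b + single m 1 = a + b + single j 1"
      by (metis add.assoc add.commute)
    with \<open>a' \<in> A\<close> ab show ?thesis by blast
  next
    assume "m \<in> keys b"
    then obtain b' where "b' \<in> B" "b' + single m 1 = b + single j 1"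
      using stableE[OF assms(2) ab(2)] \<open>j < m\<close> by blast
    then have "a + b' + single m 1 = a + b + single j 1"
      by (simp add: add.assoc)
    with \<open>b' \<in> B\<close> ab show ?thesis by blast
  qed
qed

lemma stable_power_monomials: "stable B \<Longrightarrow> stable (power_monomials B k)"
  by (induction k) (auto simp: stable_sum, simp add: stable_def)

lemma total_degree_power_monomials:
  assumes "\<And>b. b \<in> B \<Longrightarrow> total_degree b = d"
  shows "w \<in> power_monomials B k \<Longrightarrow> total_degree w = k * d"
proof (induction k arbitrary: w)
  case 0
  then show ?case by (simp add: total_degree_def)
qed (auto simp: total_degree_add assms)

text \<open>A generator \<open>w\<close> of the \<open>(k+1)\<close>-st power is a product of \<open>k + 1 \<ge> 2\<close> generators of \<open>I\<close>, so a factor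
  can be removed from it without losing its largest variable.\<close>

lemma eliahou_kervaire_power_Suc:
  assumes "k \<ge> 1"
  shows "eliahou_kervaire (power_monomials B (Suc k)) i =
    {b + a | b a. b \<in> B \<and> a \<in> eliahou_kervaire (power_monomials B k) i}"
proof (intro subset_antisym subsetI)
  fix a assume "a \<in> eliahou_kervaire (power_monomials B (Suc k)) i"
  then obtain b w G where a: "a = b + w + squarefree G" "b \<in> B" "w \<in> power_monomials B k" "card G = i"
      and G: "\<forall>g\<in>G. \<exists>m\<in>keys (b + w). g < m"
    by (auto simp: eliahou_kervaire_def)
  have "\<exists>b' w'. b + w = b' + w' \<and> b' \<in> B \<and> w' \<in> power_monomials B k \<and> (\<forall>g\<in>G. \<exists>m\<in>keys w'. g < m)"
  proof (cases "G = {}")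
    case False
    then obtain m where m: "m \<in> keys (b + w)" "Max G < m"
      using G by (meson Max_in finite)
    then have Gm: "g < m" if "g \<in> G" for g
      using that by (meson Max_ge finite order_le_less_trans)
    show ?thesis
    proof (cases "m \<in> keys w")
      case True
      with a Gm show ?thesis by blast
    next
      case False
      then have mb: "m \<in> keys b" using m(1) keys_add[of b w] by blast
      \<comment> \<open>If \<open>m\<close> occurs in \<open>b\<close> but not in \<open>w\<close>,
        a factor \<open>c\<close> of \<open>w\<close> is removed instead of \<open>b\<close>, and
        \<open>b\<close> joins the remaining product; \<open>k \<ge> 1\<close> provides such a
        factor.\<close>
      obtain k' where k': "k = Suc k'" using assms by (cases k) auto
      then obtain c w0 where w: "w = c + w0" "c \<in> B" "w0 \<in> power_monomials B k'"
        using a(3) by auto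
      have "m \<in> keys (b + w0)" using mb by (simp add: in_keys_iff lookup_add)
      moreover have "b + w0 \<in> power_monomials B k" using a(2) w(3) k' by auto
      moreover have "b + w = c + (b + w0)" using w(1) by (simp add: ac_simps)
      ultimately show ?thesis using w(2) Gm by blast
    qed
  qed (use a in blast)
  then obtain b' w' where *: "b + w = b' + w'" "b' \<in> B" "w' \<in> power_monomials B k" "\<forall>g\<in>G. \<exists>m\<in>keys w'. g < m"
    by blast
  then have "a = b' + (w' + squarefree G)"
    using a(1) by (simp add: add.assoc)
  moreover have "w' + squarefree G \<in> eliahou_kervaire (power_monomials B k) i"
    using * a(4) unfolding eliahou_kervaire_def by blast
  ultimately show "a \<in> {b + a | b a. b \<in> B \<and> a \<in> eliahou_kervaire (power_monomials B k) i}"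
    using *(2) by blast
next
  fix a assume "a \<in> {b + a | b a. b \<in> B \<and> a \<in> eliahou_kervaire (power_monomials B k) i}"
  then obtain b w G where a: "a = b + (w + squarefree G)" "b \<in> B" "w \<in> power_monomials B k" "card G = i"
      and G: "\<forall>g\<in>G. \<exists>m\<in>keys w. g < m"
    by (auto simp: eliahou_kervaire_def)
  have "a = (b + w) + squarefree G" using a(1) by (simp add: add.assoc)
  moreover have "b + w \<in> power_monomials B (Suc k)" using a by auto
  moreover have "keys w \<subseteq> keys (b + w)" by (auto simp: in_keys_iff lookup_add)
  ultimately show "a \<in> eliahou_kervaire (power_monomials B (Suc k)) i"
    using a(4) G unfolding eliahou_kervaire_def by blast
qed

theorem proposition5p2:
  fixes u :: "'n::{finite, linorder} monom"
    and I :: "('n, 'k::field) mpoly set"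
    and i k :: nat
  assumes "I = principal_borel u"
    and "k \<ge> 1"
  shows "HS i (ideal_power I (k + 1)) = ideal_mult I (HS i (ideal_power I k))"
proof -
  let ?B = "borel_monomials u"
  have I: "I = ideal.span (monomial ` ?B)"
    using assms(1) by (simp add: principal_borel_eq)
  \<comment> \<open>The generators of the \<open>l\<close>-th power share the total degree
    \<open>l * total_degree u\<close>, as the formula for stable sets requires.\<close>
  have HS: "HS i (ideal_power I l) = ideal.span (monomial ` eliahou_kervaire (power_monomials ?B l) i)" for l
    unfolding I ideal_power_monomial
    by (rule HS_stable[OF stable_power_monomials[OF stable_borel_monomials]
          total_degree_power_monomials[OF total_degree_borel_monomials]])
  show ?thesis
    unfolding HS using assms(2)
    by (simp only: I ideal_mult_monomial Suc_eq_plus1[symmetric] eliahou_kervaire_power_Suc)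
qed

end
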